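(* Let $d=2$, $\alpha=0$, $c>0$, let $\eta\in L^1(S^1)$, $\eta\ge 0$, be a light intensity function, and define $$K=\max_{|\mathbf w|=1}\int_{\mathbf n\in S^1}\big|\langle\mathbf w,\mathbf n\rangle\big|\,\eta(\mathbf n)\,d\mathbf n ,$$ where the maximum is over unit vectors $\mathbf w\in\mathbb R^2$. Consider the problem of finding a positive measure $\mu$ supported on $\mathbb R^2_+=\{(x_1,x_2):x_2\ge0\}$ which maximizes the payoff $\mathcal S^\eta(\mu)-c\,\mathcal I^0(\mu)$. (i) If $K>c$, then this optimization problem has no solution, because the supremum of all possible payoffs is $+\infty$. (ii) If $K\le c$, then the maximum payoff is zero, which is trivially achieved by the zero measure.
   Context: All measures are positive, bounded Radon measures; $\langle\cdot,\cdot\rangle$ is the Euclidean inner product and $S^1$ is the unit circle in $\mathbb R^2$. Sunlight functional. For $\mathbf n\in S^1$, let $E_{\mathbf n}^\perp\subset\mathbb R^2$ be the line through the origin perpendicular to $\mathbf n$, and $\pi_{\mathbf n}:\mathbb R^2\to E_{\mathbf n}^\perp$ the perpendicular projection. For a measure $\mu$, let $\mu^{\mathbf n}(A)=\mu(\{x:\pi_{\mathbf n}(x)\in A\})$ be the projected measure and let $\Phi^{\mathbf n}$ be the density of the absolutely continuous part of $\mu^{\mathbf n}$ with respect to 1-dimensional Lebesgue measure on $E_{\mathbf n}^\perp$. Then $$\mathcal S^\eta(\mu)=\int_{S^1}\Big(\int_{E_{\mathbf n}^\perp}\big(1-\exp\{-\Phi^{\mathbf n}(y)\}\big)\,dy\Big)\eta(\mathbf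 n)\,d\mathbf n .$$ Irrigation cost. Let $M=\mu(\mathbb R^2)$ and $\Theta=[0,M]$. A measurable map $\chi:\Theta\times\mathbb R_+\to\mathbb R^2$ is an admissible irrigation plan for $\mu$ if: (i) for every $\xi\in\Theta$ the map $t\mapsto\chi(\xi,t)$ is Lipschitz and there is a stopping time $T(\xi)$ such that $|\dot\chi(\xi,t)|=1$ for a.e. $t\in[0,T(\xi)]$ and $\dot\chi(\xi,t)=0$ for $t>T(\xi)$ (dot denotes $\partial/\partial t$); (ii) $\chi(\xi,0)=0$ for all $\xi$; (iii) the push-forward of Lebesgue measure on $[0,M]$ under $\xi\mapsto\chi(\xi,T(\xi))$ is $\mu$. The flux through a point $x$ is $|x|_\chi=\mathrm{meas}(\{\xi\in\Theta:\chi(\xi,t)=x\text{ for some }t\ge0\})$. For $\alpha\in[0,1]$, $$\mathcal E^\alpha(\chi)=\int_\Theta\Big(\int_0^{T(\xi)}|\chi(\xi,t)|_\chi^{\alpha-1}\,dt\Big)d\xi,\qquad \mathcal I^\alpha(\mu)=\inf_\chi\mathcal E^\alpha(\chi),$$ the infimum being over all admissible irrigation plans for $\mu$ (here $\alpha=0$). A measure with $\mathcal I^0(\mu)=+\infty$ has payoff $-\infty$. *)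

theory Defs
  imports "HOL-Analysis.Analysis"
begin

section \<open>The Lebesgue decomposition\<close>

definition lebesgue_decomposition ::
    "'a measure \<Rightarrow> 'a measure \<Rightarrow> 'a measure \<Rightarrow> 'a measure \<Rightarrow> bool" where
  "lebesgue_decomposition L \<nu> \<nu>\<^sub>a \<nu>\<^sub>s \<longleftrightarrow>
     sets \<nu>\<^sub>a = sets L \<and> sets \<nu>\<^sub>s = sets L \<and>
     (\<forall>A\<in>sets L. emeasure \<nu> A = emeasure \<nu>\<^sub>a A + emeasure \<nu>\<^sub>s A) \<and>
     absolutely_continuous L \<nu>\<^sub>a \<and>
     (\<exists>N\<in>null_sets L. emeasure \<nu>\<^sub>s (space L - N) = 0)"

definition ac_part :: "'a measure \<Rightarrow> 'a measure \<Rightarrow> 'a measure" where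
  "ac_part L \<nu> = (THE \<nu>\<^sub>a. \<exists>\<nu>\<^sub>s. lebesgue_decomposition L \<nu> \<nu>\<^sub>a \<nu>\<^sub>s)"

lemma lebesgue_decomposition_exists:
  assumes "finite_measure \<nu>" and sets[measurable_cong]: "sets \<nu> = sets L"
  shows "\<exists>\<nu>\<^sub>a \<nu>\<^sub>s. lebesgue_decomposition L \<nu> \<nu>\<^sub>a \<nu>\<^sub>s"
proof -
  interpret finite_measure \<nu> by fact
  have sp: "space \<nu> = space L" using sets by (rule sets_eq_imp_space_eq)
  define S where "S = (SUP N\<in>null_sets L. emeasure \<nu> N)"
  have "null_sets L \<noteq> {}" by auto
  then obtain F where F: "range F \<subseteq> emeasure \<nu> ` null_sets L" "S = (SUP i::nat. F i)"
    using ennreal_Sup_countable_SUP[of "emeasure \<nu> ` null_sets L"] unfolding S_def by auto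
  have "\<forall>i. \<exists>N\<in>null_sets L. F i = emeasure \<nu> N" using F(1) by blast
  then obtain G where G: "\<And>i. G i \<in> null_sets L" "\<And>i. F i = emeasure \<nu> (G i)" by metis
  define N where "N = (\<Union>i. G i)"
  have N: "N \<in> null_sets L" unfolding N_def using G(1) by (rule null_sets_UN)
  then have Nm[measurable]: "N \<in> sets L" by auto
  have "S \<le> emeasure \<nu> N" unfolding F(2)
    by (rule SUP_least) (auto simp: G(2) N_def sets intro!: emeasure_mono G(1)[THEN null_setsD2] sets.countable_UN)
  define a where "a = density \<nu> (indicator (space L - N))"
  define s where "s = density \<nu> (indicator N)"
  have ea: "emeasure a A = emeasure \<nu> (A - N)" if [measurable]: "A \<in> sets L" for A
  proof -
    have "(space L - N) \<inter> A = A - N" using sets.sets_into_space[OF that] by auto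
    then show ?thesis unfolding a_def by (subst emeasure_restricted) (auto simp: sets)
  qed
  have es: "emeasure s A = emeasure \<nu> (A \<inter> N)" if [measurable]: "A \<in> sets L" for A
    unfolding s_def by (subst emeasure_restricted) (auto simp: sets Int_commute)
  have "absolutely_continuous L a"
    unfolding absolutely_continuous_def
  proof
    fix A assume A: "A \<in> null_sets L"
    then have [measurable]: "A \<in> sets L" by auto
    have "emeasure \<nu> N + emeasure \<nu> (A - N) = emeasure \<nu> (N \<union> A)"
      by (subst plus_emeasure) (auto simp: sets intro!: arg_cong[where f="emeasure \<nu>"])
    also have "\<dots> \<le> S" unfolding S_def using N A by (intro SUP_upper) auto
    also have "\<dots> \<le> emeasure \<nu> N" by fact
    finally have "emeasure \<nu> N + emeasure \<nu> (A - N) \<le> emeasure \<nu> N + 0" by simp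
    then have "emeasure \<nu> (A - N) = 0"
      by (subst (asm) ennreal_add_left_cancel_le) (auto simp: emeasure_eq_measure)
    then show "A \<in> null_sets a" using ea[of A] by (auto simp: a_def sets)
  qed
  moreover have "emeasure \<nu> A = emeasure a A + emeasure s A" if [measurable]: "A \<in> sets L" for A
    unfolding ea[OF that] es[OF that]
    by (subst plus_emeasure) (auto simp: sets intro!: arg_cong[where f="emeasure \<nu>"])
  moreover have "emeasure s (space L - N) = 0"
    by (subst es) (auto simp: Diff_Int_distrib2)
  ultimately show ?thesis
    unfolding lebesgue_decomposition_def using N
    by (intro exI[of _ a] exI[of _ s]) (auto simp: a_def s_def sets)
qed

lemma lebesgue_decomposition_unique:
  assumes "lebesgue_decomposition L \<nu> a s" "lebesgue_decomposition L \<nu> a' s'"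
  shows "a = a'"
proof (rule measure_eqI)
  have sets: "sets a = sets L" "sets a' = sets L" "sets s = sets L" "sets s' = sets L"
    using assms by (auto simp: lebesgue_decomposition_def)
  then show "sets a = sets a'" by simp
  obtain N N' where N: "N \<in> null_sets L" "emeasure s (space L - N) = 0"
    and N': "N' \<in> null_sets L" "emeasure s' (space L - N') = 0"
    using assms unfolding lebesgue_decomposition_def by blast
  define Z where "Z = N \<union> N'"
  have Z: "Z \<in> null_sets L" using N N' unfolding Z_def by auto
  then have Zm: "Z \<in> sets L" by auto
  fix A assume "A \<in> sets a"
  then have A: "A \<in> sets L" by (simp add: sets)
  have sub: "A - Z \<subseteq> space L - N" "A - Z \<subseteq> space L - N'"
    using sets.sets_into_space[OF A] by (auto simp: Z_def)
  have s0: "emeasure s (A - Z) = 0"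
    using emeasure_mono[OF sub(1), of s] N by (auto simp: sets)
  have s0': "emeasure s' (A - Z) = 0"
    using emeasure_mono[OF sub(2), of s'] N' by (auto simp: sets)
  have AZ: "A - Z \<in> sets L" using A Zm by auto
  have "Z \<in> null_sets a" "Z \<in> null_sets a'"
    using Z assms unfolding lebesgue_decomposition_def absolutely_continuous_def by auto
  then have "emeasure a (A - Z) = emeasure a A" "emeasure a' (A - Z) = emeasure a' A"
    using A by (auto intro!: emeasure_Diff_null_set simp: sets)
  moreover have "emeasure a (A - Z) = emeasure a' (A - Z)"
    using assms AZ s0 s0' unfolding lebesgue_decomposition_def by (metis add.right_neutral)
  ultimately show "emeasure a A = emeasure a' A" by simp
qed

section \<open>The sunlight functional\<close>

abbreviation unit_circle :: "(real^2) set" where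
  "unit_circle \<equiv> sphere 0 1"

text \<open>Arc length on the unit circle, as the image of Lebesgue measure under the angular
  parametrization.\<close>

definition arc_length :: "(real^2) measure" where
  "arc_length = distr (restrict_space lborel {0..<2*pi}) (restrict_space borel unit_circle)
                  (\<lambda>\<theta>. vector [cos \<theta>, sin \<theta>])"

definition perp_line :: "real^2 \<Rightarrow> (real^2) set" where
  "perp_line n = {y. y \<bullet> n = 0}"

text \<open>The next two definitions are meant for unit vectors \<open>n\<close>.\<close>

definition perp_proj :: "real^2 \<Rightarrow> real^2 \<Rightarrow> real^2" where
  "perp_proj n x = x - (x \<bullet> n) *\<^sub>R n"

text \<open>One-dimensional Lebesgue measure on the line, as the image of Lebesgue measure on the reals
  under the isometry \<open>s \<mapsto> s n\<^sup>\<bottom>\<close>, where \<open>n\<^sup>\<bottom>\<close> is \<open>n\<close> rotated by a right angle.\<close>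

definition perp_line_lebesgue :: "real^2 \<Rightarrow> (real^2) measure" where
  "perp_line_lebesgue n = distr lborel (restrict_space borel (perp_line n))
                            (\<lambda>s. s *\<^sub>R vector [- n $ 2, n $ 1])"

definition projected_measure :: "real^2 \<Rightarrow> (real^2) measure \<Rightarrow> (real^2) measure" where
  "projected_measure n \<mu> = distr \<mu> (restrict_space borel (perp_line n)) (perp_proj n)"

text \<open>The density is finite almost everywhere for a finite measure, so \<^const>\<open>enn2real\<close> changes it
  on a null set only.\<close>

definition projected_density :: "(real^2) measure \<Rightarrow> real^2 \<Rightarrow> real^2 \<Rightarrow> real" where
  "projected_density \<mu> n y =
     enn2real (RN_deriv (perp_line_lebesgue n)
       (ac_part (perp_line_lebesgue n) (projected_measure n \<mu>)) y)"

definition sunlight :: "(real^2 \<Rightarrow> real) \<Rightarrow> (real^2) measure \<Rightarrow> ennreal" where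
  "sunlight \<eta> \<mu> =
     (\<integral>\<^sup>+ n. (\<integral>\<^sup>+ y. ennreal (1 - exp (- projected_density \<mu> n y)) \<partial>perp_line_lebesgue n)
             * ennreal (\<eta> n) \<partial>arc_length)"

section \<open>The irrigation cost\<close>

abbreviation total_mass :: "(real^2) measure \<Rightarrow> real" where
  "total_mass \<mu> \<equiv> measure \<mu> (space \<mu>)"

text \<open>The stopping time \<open>T\<close> is uniquely determined on \<open>\<Theta> = [0, M]\<close> by the path family \<open>\<gamma>\<close>; it is
  carried as a separate argument. Values of \<open>\<gamma>\<close> and \<open>T\<close> outside \<open>\<Theta> \<times> [0, \<infinity>)\<close> are irrelevant.\<close>

definition irrigation_plan ::
    "(real^2) measure \<Rightarrow> (real \<Rightarrow> real \<Rightarrow> real^2) \<Rightarrow> (real \<Rightarrow> real) \<Rightarrow> bool" where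
  "irrigation_plan \<mu> \<gamma> T \<longleftrightarrow>
     (\<lambda>(\<xi>, t). \<gamma> \<xi> t) \<in>
       borel_measurable (lebesgue_on {0..total_mass \<mu>} \<Otimes>\<^sub>M lebesgue_on {0..}) \<and>
     (\<forall>\<xi>\<in>{0..total_mass \<mu>}.
        (\<exists>C. C-lipschitz_on {0..} (\<gamma> \<xi>)) \<and>
        0 \<le> T \<xi> \<and>
        (AE t in lebesgue_on {0..T \<xi>}.
           \<exists>v. (\<gamma> \<xi> has_vector_derivative v) (at t) \<and> norm v = 1) \<and>
        (\<forall>t>T \<xi>. (\<gamma> \<xi> has_vector_derivative 0) (at t)) \<and>
        \<gamma> \<xi> 0 = 0) \<and>
     distr (lebesgue_on {0..total_mass \<mu>}) borel (\<lambda>\<xi>. \<gamma> \<xi> (T \<xi>)) = \<mu>"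

definition flux :: "real \<Rightarrow> (real \<Rightarrow> real \<Rightarrow> real^2) \<Rightarrow> real^2 \<Rightarrow> real" where
  "flux M \<gamma> x = measure lebesgue {\<xi>\<in>{0..M}. \<exists>t\<ge>0. \<gamma> \<xi> t = x}"

text \<open>\<open>m\<close> to the power \<open>\<alpha> - 1\<close>, with value \<open>\<infinity>\<close> at \<open>m = 0\<close> for \<open>\<alpha> < 1\<close> and with \<open>0\<close> to the power
  \<open>0\<close> equal to \<open>1\<close>; the library's \<open>powr\<close> has value \<open>0\<close> in both of these cases.\<close>

definition flux_weight :: "real \<Rightarrow> real \<Rightarrow> ennreal" where
  "flux_weight \<alpha> m =
     (if \<alpha> = 1 then 1 else if m = 0 then \<infinity> else ennreal (m powr (\<alpha> - 1)))"

definition plan_cost ::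
    "real \<Rightarrow> real \<Rightarrow> (real \<Rightarrow> real \<Rightarrow> real^2) \<Rightarrow> (real \<Rightarrow> real) \<Rightarrow> ennreal" where
  "plan_cost \<alpha> M \<gamma> T =
     (\<integral>\<^sup>+ \<xi>. (\<integral>\<^sup>+ t. flux_weight \<alpha> (flux M \<gamma> (\<gamma> \<xi> t)) \<partial>lebesgue_on {0..T \<xi>})
        \<partial>lebesgue_on {0..M})"

definition irrigation_cost :: "real \<Rightarrow> (real^2) measure \<Rightarrow> ennreal" where
  "irrigation_cost \<alpha> \<mu> = Inf {plan_cost \<alpha> (total_mass \<mu>) \<gamma> T | \<gamma> T. irrigation_plan \<mu> \<gamma> T}"

section \<open>The optimization problem\<close>

definition payoff :: "(real^2 \<Rightarrow> real) \<Rightarrow> real \<Rightarrow> real \<Rightarrow> (real^2) measure \<Rightarrow> ereal" where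
  "payoff \<eta> c \<alpha> \<mu> =
     (if irrigation_cost \<alpha> \<mu> = \<infinity> then - \<infinity>
      else enn2ereal (sunlight \<eta> \<mu>) - ereal c * enn2ereal (irrigation_cost \<alpha> \<mu>))"

text \<open>Every finite Borel measure on the plane is a Radon measure. Since the upper half plane is
  closed, it contains the support of a measure iff its complement is a null set.\<close>

definition half_plane_measures :: "(real^2) measure set" where
  "half_plane_measures =
     {\<mu>. finite_measure \<mu> \<and> sets \<mu> = sets borel \<and> emeasure \<mu> {x. x $ 2 < 0} = 0}"

definition directional_light :: "(real^2 \<Rightarrow> real) \<Rightarrow> real^2 \<Rightarrow> real" where
  "directional_light \<eta> w = (\<integral>n. \<bar>w \<bullet> n\<bar> * \<eta> n \<partial>arc_length)"

definition max_light :: "(real^2 \<Rightarrow> real) \<Rightarrow> real" where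
  "max_light \<eta> = (SUP w\<in>unit_circle. directional_light \<eta> w)"

lemma max_light_is_maximum:
  assumes "integrable arc_length \<eta>"
  shows "\<exists>w\<in>unit_circle. max_light \<eta> = directional_light \<eta> w \<and>
           (\<forall>w'\<in>unit_circle. directional_light \<eta> w' \<le> directional_light \<eta> w)"
proof -
  have sp: "space arc_length = unit_circle"
    by (simp add: arc_length_def space_restrict_space)
  have [measurable]: "(\<lambda>n. \<bar>w \<bullet> n\<bar>) \<in> borel_measurable arc_length" for w
    unfolding arc_length_def by (simp, rule measurable_restrict_space1, measurable)
  have int: "integrable arc_length (\<lambda>n. \<bar>w \<bullet> n\<bar> * \<eta> n)" for w
  proof (rule Bochner_Integration.integrable_bound[where f="\<lambda>n. norm w * \<eta> n"])
    show "AE n in arc_length. norm (\<bar>w \<bullet> n\<bar> * \<eta> n) \<le> norm (norm w * \<eta> n)"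
    proof (rule AE_I2)
      fix n assume "n \<in> space arc_length"
      then have "\<bar>w \<bullet> n\<bar> \<le> norm w" using Cauchy_Schwarz_ineq2[of w n] by (simp add: sp)
      then show "norm (\<bar>w \<bullet> n\<bar> * \<eta> n) \<le> norm (norm w * \<eta> n)"
        by (auto simp: abs_mult intro!: mult_right_mono)
    qed
  qed (use assms in auto)
  define C where "C = (\<integral>n. \<bar>\<eta> n\<bar> \<partial>arc_length)"
  have "C-lipschitz_on UNIV (directional_light \<eta>)"
  proof (rule lipschitz_onI)
    show "0 \<le> C" unfolding C_def by simp
    fix v w :: "real^2"
    have "dist (directional_light \<eta> v) (directional_light \<eta> w)
        = \<bar>\<integral>n. \<bar>v \<bullet> n\<bar> * \<eta> n - \<bar>w \<bullet> n\<bar> * \<eta> n \<partial>arc_length\<bar>"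
      unfolding directional_light_def dist_real_def using int by simp
    also have "\<dots> \<le> (\<integral>n. \<bar>\<bar>v \<bullet> n\<bar> * \<eta> n - \<bar>w \<bullet> n\<bar> * \<eta> n\<bar> \<partial>arc_length)"
      by (rule integral_abs_bound)
    also have "\<dots> \<le> (\<integral>n. norm (v - w) * \<bar>\<eta> n\<bar> \<partial>arc_length)"
    proof (rule integral_mono)
      fix n assume "n \<in> space arc_length"
      then have "\<bar>(v - w) \<bullet> n\<bar> \<le> norm (v - w)"
        using Cauchy_Schwarz_ineq2[of "v - w" n] by (simp add: sp)
      then have "\<bar>\<bar>v \<bullet> n\<bar> - \<bar>w \<bullet> n\<bar>\<bar> \<le> norm (v - w)" by (simp add: inner_diff_left)
      then show "\<bar>\<bar>v \<bullet> n\<bar> * \<eta> n - \<bar>w \<bullet> n\<bar> * \<eta> n\<bar> \<le> norm (v - w) * \<bar>\<eta> n\<bar>"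
        by (auto simp: abs_mult simp flip: left_diff_distrib intro!: mult_right_mono)
    qed (use assms int in auto)
    also have "\<dots> = C * dist v w" by (simp add: C_def dist_norm mult.commute)
    finally show "dist (directional_light \<eta> v) (directional_light \<eta> w) \<le> C * dist v w" .
  qed
  then have "continuous_on unit_circle (directional_light \<eta>)"
    using lipschitz_on_continuous_on continuous_on_subset by blast
  moreover have "axis 1 1 \<in> unit_circle" by simp
  ultimately obtain w where w: "w \<in> unit_circle"
      "\<forall>w'\<in>unit_circle. directional_light \<eta> w' \<le> directional_light \<eta> w"
    using continuous_attains_sup[of unit_circle "directional_light \<eta>"] by auto
  moreover have "max_light \<eta> = directional_light \<eta> w"
    unfolding max_light_def using w by (intro cSup_eq_maximum) auto
  ultimately show ?thesis by blast
qed

end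

theory Submission imports Defs begin

text \<open>Upper bound: fix an irrigation plan and a unit vector \<open>n\<close>, and let \<open>m s\<close> be the mass of the
  particles that meet the line \<open>\<langle>x, n\<^sup>\<bottom>\<rangle> = s\<close>. The flux through a point of this line is at most \<open>m s\<close>, so
  integrating the inverse flux times \<open>|\<langle>velocity, n\<^sup>\<bottom>\<rangle>|\<close> along all particles gives at least
  \<open>\<integral> m s / m s ds = |{m > 0}|\<close>, and the projected density vanishes almost everywhere outside \<open>{m > 0}\<close>.
  Integrating over \<open>n\<close> turns the velocity, which has norm one, into a factor of at most \<open>K\<close>; so
  the sunlight is at most \<open>K\<close> times the cost.

  Lower bound: a segment of length \<open>R\<close> with uniform density \<open>\<kappa>\<close>, orthogonal to a maximizer \<open>w\<close>, costs
  at most \<open>R\<close> and collects sunlight at least \<open>R (1 - exp (-\<kappa>)) K\<close>. If \<open>K > c\<close>, a large \<open>\<kappa>\<close> makes the payoff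
  grow linearly in \<open>R\<close> without bound.\<close>

section \<open>Lipschitz functions of one variable\<close>

text \<open>Each particle only has to pay once for every level it meets, so a one-sided estimate for
  images of Lipschitz functions suffices; multiplicities of crossings never have to be measured. The
  delicate point is that the projected measure does not charge {m = 0}. A level s with m s = 0 is
  missed by almost every particle, but the exceptional set depends on s and there may be uncountably
  many such levels. All paths start at the origin, so a particle that misses s ends on the origin's
  side of s. These events are monotone in s, and countably many levels decide all of them. Stopping
  times are not assumed measurable in the particle. Hence everything is read off from the path: the
  velocity, whose norm records the stopping, the eventual value, and the approach to a point at
  rational times. With exponent 0 the cost of a segment is bounded by its length whatever its
  density, so raising \<kappa> is free. An infinite supremum alone would not exclude a measure with
  payoff +infinity; the upper bound does, because finite cost forces finite sunlight.\<close>

lemma emeasure_image_le_nn_integral_derivative: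
  fixes f :: "real \<Rightarrow> real"
  assumes S: "S \<in> lmeasurable"
    and der: "\<And>x. x \<in> S \<Longrightarrow> (f has_real_derivative d x) (at x within S)"
    and d: "d \<in> borel_measurable (lebesgue_on S)"
    and bound: "\<And>x. x \<in> S \<Longrightarrow> \<bar>d x\<bar> \<le> C"
  shows "f ` S \<in> sets lebesgue"
    and "emeasure lebesgue (f ` S) \<le> (\<integral>\<^sup>+x. ennreal \<bar>d x\<bar> \<partial>lebesgue_on S)"
proof -
  \<comment> \<open>The area inequality \<open>measure_differentiable_image\<close> concerns maps of
    \<open>real^'n\<close>. Conjugating \<open>f\<close> with \<open>vec\<close> moves it to
    dimension one, where the Jacobian determinant is the derivative itself.\<close>
  let ?lift = "vec :: real \<Rightarrow> real^1"
  let ?drop = "\<lambda>x::real^1. x $ 1"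
  have Sm: "S \<in> sets lebesgue" using S by auto
  interpret finite_measure "lebesgue_on S" by (rule finite_measure_lebesgue_on[OF S])
  have int: "integrable (lebesgue_on S) (\<lambda>x. \<bar>d x\<bar>)"
    using d bound by (intro integrable_const_bound[where B=C]) auto
  then have "set_integrable lebesgue S (\<lambda>x. \<bar>d x\<bar>)"
    by (simp add: integrable_restrict_space set_integrable_def Sm)
  then have intS: "(\<lambda>x. \<bar>d x\<bar>) integrable_on S"
    by (rule set_lebesgue_integral_eq_integral)
  have eqint: "integral S (\<lambda>x. \<bar>d x\<bar>) = (\<integral>x. \<bar>d x\<bar> \<partial>lebesgue_on S)"
    using lebesgue_integral_eq_integral[OF int Sm] by simp
  have liftS: "?lift ` S \<in> sets lebesgue"
    by (auto intro: differentiable_image_in_sets_lebesgue [OF Sm] differentiable_vec)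
  have der': "(?lift \<circ> f \<circ> ?drop has_derivative (*\<^sub>R) (d (?drop x))) (at x within ?lift ` S)"
    if x: "x \<in> ?lift ` S" for x
  proof -
    obtain z where z: "z \<in> S" "x = vec z" using x by auto
    have "((\<lambda>x. vec (f (x $ 1))) has_derivative (*\<^sub>R) (d z)) (at (vec z) within ?lift ` S)"
      using der[OF z(1)]
      by (intro has_derivative_vector_1) (simp add: has_field_derivative_def mult.commute[of _ "d z"])
    then show ?thesis by (simp add: z o_def)
  qed
  have det: "\<bar>det (matrix ((*\<^sub>R) (a::real) :: real^1 \<Rightarrow> real^1))\<bar> = \<bar>a\<bar>" for a
    by (simp add: det_1 matrix_def axis_def)
  have int1: "(\<lambda>x. \<bar>det (matrix ((*\<^sub>R) (d (?drop x)) :: real^1 \<Rightarrow> real^1))\<bar>) integrable_on ?lift ` S"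
    and int2: "integral (?lift ` S) (\<lambda>x. \<bar>det (matrix ((*\<^sub>R) (d (?drop x)) :: real^1 \<Rightarrow> real^1))\<bar>)
       = integral S (\<lambda>x. \<bar>d x\<bar>)"
  proof -
    have "((\<lambda>x. \<bar>d x\<bar>) has_integral integral S (\<lambda>x. \<bar>d x\<bar>)) S" using intS by blast
    then have "((\<lambda>x. \<bar>d (?drop x)\<bar>) has_integral integral S (\<lambda>x. \<bar>d x\<bar>)) (?lift ` S)"
      by (intro has_integral_vec1_D) (simp add: o_def image_comp)
    then show "(\<lambda>x. \<bar>det (matrix ((*\<^sub>R) (d (?drop x)) :: real^1 \<Rightarrow> real^1))\<bar>) integrable_on ?lift ` S"
      "integral (?lift ` S) (\<lambda>x. \<bar>det (matrix ((*\<^sub>R) (d (?drop x)) :: real^1 \<Rightarrow> real^1))\<bar>)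
       = integral S (\<lambda>x. \<bar>d x\<bar>)"
      unfolding det by blast+
  qed
  define I where "I = (?lift \<circ> f \<circ> ?drop) ` ?lift ` S"
  have I: "I \<in> lmeasurable" "measure lebesgue I \<le> integral S (\<lambda>x. \<bar>d x\<bar>)"
    using measurable_differentiable_image[OF liftS der' int1]
      measure_differentiable_image[OF liftS der' int1] unfolding I_def int2 by simp_all
  have IfS: "?drop ` I = f ` S" by (auto simp: I_def image_comp)
  \<comment> \<open>The measure of the image returns to the real line as the integral of the
    constant 1.\<close>
  have "((\<lambda>x. 1::real) has_integral measure lebesgue I) I" using I(1)
    by (simp add: has_integral_iff lmeasurable_iff_integrable_on lmeasure_integral)
  from has_integral_vec1_I[OF this]
  have hi: "((\<lambda>x. 1::real) has_integral measure lebesgue I) (f ` S)" by (simp add: IfS o_def)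
  then have fS: "f ` S \<in> lmeasurable" by (simp add: has_integral_iff lmeasurable_iff_integrable_on)
  then show "f ` S \<in> sets lebesgue" by auto
  have "measure lebesgue (f ` S) = measure lebesgue I"
    using hi fS by (simp add: has_integral_iff lmeasure_integral)
  then have "measure lebesgue (f ` S) \<le> (\<integral>x. \<bar>d x\<bar> \<partial>lebesgue_on S)" using I(2) eqint by simp
  then show "emeasure lebesgue (f ` S) \<le> (\<integral>\<^sup>+x. ennreal \<bar>d x\<bar> \<partial>lebesgue_on S)"
    using fS by (simp add: nn_integral_eq_integral[OF int] emeasure_eq_measure2)
qed

text \<open>One half of the area formula: on the right a value \<open>s\<close> is counted as often
  as \<open>f\<close> takes it, on the left once. The half line has infinite measure and
  \<open>f\<close> is differentiable only almost everywhere, so indicators are treated by exhausting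
  the half line and discarding a null set; general \<open>g\<close> follow by monotone
  approximation.\<close>

lemma Lipschitz_image_nn_integral_le:
  fixes f :: "real \<Rightarrow> real" and g :: "real \<Rightarrow> ennreal"
  assumes lip: "C-lipschitz_on {0..} f"
    and der: "AE t in lebesgue_on {0..}. (f has_real_derivative d t) (at t)"
    and d: "d \<in> borel_measurable (lebesgue_on {0..})"
    and g: "g \<in> borel_measurable borel"
  shows "(\<integral>\<^sup>+s. indicator (f ` {0..}) s * g s \<partial>lborel)
     \<le> (\<integral>\<^sup>+t. g (f t) * ennreal \<bar>d t\<bar> \<partial>lebesgue_on {0..})"
  using g
proof (induction g rule: borel_measurable_induct)
  have cont: "continuous_on {0..} f" using lip by (rule lipschitz_on_continuous_on)
  then have fm[measurable]: "f \<in> borel_measurable (lebesgue_on {0..})"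
    by (simp add: continuous_imp_measurable_on_sets_lebesgue)
  note d[measurable]
  have "is_interval (f ` {0..})"
    using cont by (auto simp: is_interval_connected_1 intro!: connected_continuous_image)
  then have R[measurable]: "f ` {0..} \<in> sets borel"
    by (rule real_interval_borel_measurable)
  have Lm: "{0::real..} \<in> sets lebesgue" by auto
  {
    case (cong g g')
    then have "g' = g" by auto
    with cong show ?case by simp
  next
    case (set B)
    then have B[measurable]: "B \<in> sets borel" by auto
    \<comment> \<open>The Lipschitz bound holds on nonnegative times only. Difference quotients from
      the right stay in that range, also at \<open>t = 0\<close>.\<close>
    have "AE t in lebesgue_on {0..}. (f has_real_derivative d t) (at t) \<and> \<bar>d t\<bar> \<le> C"
      using der
    proof (rule AE_mp, intro AE_I2 impI)
      fix t assume "t \<in> space (lebesgue_on {0::real..})" and f': "(f has_real_derivative d t) (at t)"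
      then have t: "0 \<le> t" by simp
      have "((\<lambda>y. (f y - f t) / (y - t)) \<longlongrightarrow> d t) (at_right t)"
        using has_field_derivative_at_within[OF f', of "{t<..}"] by (simp add: has_field_derivative_iff)
      then have "((\<lambda>y. \<bar>(f y - f t) / (y - t)\<bar>) \<longlongrightarrow> \<bar>d t\<bar>) (at_right t)"
        by (rule tendsto_rabs)
      moreover have "\<forall>\<^sub>F y in at_right t. \<bar>(f y - f t) / (y - t)\<bar> \<le> C"
        unfolding eventually_at_right_field
      proof (intro exI[of _ "t + 1"] conjI allI impI)
        fix y assume y: "t < y" "y < t + 1"
        then have "\<bar>f y - f t\<bar> \<le> C * \<bar>y - t\<bar>"
          using lipschitz_onD[OF lip, of y t] t by (simp add: dist_real_def)
        then show "\<bar>(f y - f t) / (y - t)\<bar> \<le> C" using y by (simp add: abs_divide divide_le_eq)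
      qed simp
      ultimately have "\<bar>d t\<bar> \<le> C" by (rule tendsto_upperbound) simp
      with f' show "(f has_real_derivative d t) (at t) \<and> \<bar>d t\<bar> \<le> C" ..
    qed
    then obtain N where N: "N \<in> null_sets (lebesgue_on {0..})"
      and good: "\<And>t. t \<in> {0..} - N \<Longrightarrow> (f has_real_derivative d t) (at t) \<and> \<bar>d t\<bar> \<le> C"
      by (auto simp: eventually_ae_filter subset_eq)
    have N0: "N \<subseteq> {0..}" "N \<in> null_sets lebesgue"
      using N by (auto simp: null_sets_restrict_space)
    then have Nm: "N \<in> sets lebesgue" by auto
    \<comment> \<open>Truncation at \<open>k\<close> gives sets of finite measure, as the area
      inequality requires; the sets increase to all good times with value in
      \<open>B\<close>.\<close>
    define G where "G k = {t \<in> {0..real k} - N. f t \<in> B}" for k :: nat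
    have pre: "{t \<in> {0..}. f t \<in> B} \<in> sets lebesgue"
    proof -
      have "f -` B \<inter> space (lebesgue_on {0..}) \<in> sets (lebesgue_on {0..})" by measurable
      also have "f -` B \<inter> space (lebesgue_on {0..}) = {t \<in> {0..}. f t \<in> B}" by auto
      finally show ?thesis using sets_restrict_space_iff[of "{0::real..}" lebesgue] Lm by auto
    qed
    have "G k = {t \<in> {0..}. f t \<in> B} \<inter> {0..real k} - N" for k
      by (auto simp: G_def)
    then have Gm: "G k \<in> sets lebesgue" for k
      using sets.Diff[OF sets.Int[OF pre, of "{0..real k}"] Nm] by simp
    have GL: "G k \<in> lmeasurable" for k
      by (rule bounded_set_imp_lmeasurable[OF bounded_subset[of "{0..real k}"] Gm]) (auto simp: G_def)
    have Gs: "f ` G k \<in> sets lebesgue"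
      and Ge: "emeasure lebesgue (f ` G k) \<le> (\<integral>\<^sup>+t. ennreal \<bar>d t\<bar> \<partial>lebesgue_on (G k))" for k
    proof -
      have "d \<in> borel_measurable (lebesgue_on (G k))"
        by (rule measurable_restrict_mono[OF d]) (auto simp: G_def)
      note * = emeasure_image_le_nn_integral_derivative[OF GL _ this, where f=f and C=C]
      show "f ` G k \<in> sets lebesgue"
        by (rule *(1)) (use good in \<open>auto simp: G_def intro: has_field_derivative_at_within\<close>)
      show "emeasure lebesgue (f ` G k) \<le> (\<integral>\<^sup>+t. ennreal \<bar>d t\<bar> \<partial>lebesgue_on (G k))"
        by (rule *(2)) (use good in \<open>auto simp: G_def intro: has_field_derivative_at_within\<close>)
    qed
    \<comment> \<open>A Lipschitz image of a null set is null, so the times without a derivative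
      contribute nothing to the image.\<close>
    have "negligible (f ` N)"
    proof (rule negligible_locally_Lipschitz_image)
      show "negligible N" using N0 by (simp add: negligible_iff_null_sets)
      show "\<exists>T B. open T \<and> x \<in> T \<and> (\<forall>y\<in>N \<inter> T. norm (f y - f x) \<le> B * norm (y - x))" if "x \<in> N" for x
        using lipschitz_onD[OF lip] N0 that
        by (intro exI[of _ UNIV] exI[of _ C]) (auto simp: dist_norm)
    qed simp
    then have fN: "f ` N \<in> null_sets lebesgue" by (simp add: negligible_iff_null_sets)
    have "(\<integral>\<^sup>+s. indicator (f ` {0..}) s * indicator B s \<partial>lborel) = emeasure lborel (f ` {0..} \<inter> B)"
      by (simp flip: indicator_inter_arith)
    also have "\<dots> = emeasure lebesgue (f ` {0..} \<inter> B)" by simp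
    also have "\<dots> \<le> emeasure lebesgue ((\<Union>k. f ` G k) \<union> f ` N)"
    proof (rule emeasure_mono)
      show "f ` {0..} \<inter> B \<subseteq> (\<Union>k. f ` G k) \<union> f ` N"
      proof
        fix s assume "s \<in> f ` {0..} \<inter> B"
        then obtain t where t: "0 \<le> t" "s = f t" "f t \<in> B" by auto
        obtain k :: nat where "t \<le> real k" using real_arch_simple by blast
        then have "t \<in> G k \<or> t \<in> N" using t by (auto simp: G_def)
        then show "s \<in> (\<Union>k. f ` G k) \<union> f ` N" using t(2) by auto
      qed
    qed (use Gs fN in auto)
    also have "\<dots> = emeasure lebesgue (\<Union>k. f ` G k)"
      using Gs fN by (intro emeasure_Un_null_set) auto
    also have "\<dots> = (SUP k. emeasure lebesgue (f ` G k))"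
      using Gs by (intro SUP_emeasure_incseq[symmetric]) (auto simp: incseq_def G_def)
    also have "\<dots> \<le> (\<integral>\<^sup>+t. indicator B (f t) * ennreal \<bar>d t\<bar> \<partial>lebesgue_on {0..})"
    proof (rule SUP_least)
      fix k
      have "(\<integral>\<^sup>+t. ennreal \<bar>d t\<bar> \<partial>lebesgue_on (G k))
        \<le> (\<integral>\<^sup>+t. indicator B (f t) * ennreal \<bar>d t\<bar> \<partial>lebesgue_on {0..})"
        by (simp add: nn_integral_restrict_space Gm, rule nn_integral_mono)
          (auto simp: G_def indicator_def)
      with Ge[of k] show "emeasure lebesgue (f ` G k)
         \<le> (\<integral>\<^sup>+t. indicator B (f t) * ennreal \<bar>d t\<bar> \<partial>lebesgue_on {0..})" by simp
    qed
    finally show ?case .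
  next
    case (mult u c)
    have "(\<integral>\<^sup>+s. indicator (f ` {0..}) s * (c * u s) \<partial>lborel) = c * (\<integral>\<^sup>+s. indicator (f ` {0..}) s * u s \<partial>lborel)"
      using mult by (subst nn_integral_cmult[symmetric]) (auto simp: ac_simps)
    also have "\<dots> \<le> c * (\<integral>\<^sup>+t. u (f t) * ennreal \<bar>d t\<bar> \<partial>lebesgue_on {0..})"
      by (intro mult_left_mono mult) auto
    also have "\<dots> = (\<integral>\<^sup>+t. c * u (f t) * ennreal \<bar>d t\<bar> \<partial>lebesgue_on {0..})"
      using mult by (subst nn_integral_cmult[symmetric]) (auto simp: ac_simps)
    finally show ?case .
  next
    case (add u v)
    have "(\<integral>\<^sup>+s. indicator (f ` {0..}) s * (v s + u s) \<partial>lborel)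
       = (\<integral>\<^sup>+s. indicator (f ` {0..}) s * v s \<partial>lborel) + (\<integral>\<^sup>+s. indicator (f ` {0..}) s * u s \<partial>lborel)"
      using add(1,3) by (subst nn_integral_add[symmetric]) (auto simp: distrib_left)
    also have "\<dots> \<le> (\<integral>\<^sup>+t. v (f t) * ennreal \<bar>d t\<bar> \<partial>lebesgue_on {0..}) + (\<integral>\<^sup>+t. u (f t) * ennreal \<bar>d t\<bar> \<partial>lebesgue_on {0..})"
      by (intro add_mono add.IH)
    also have "\<dots> = (\<integral>\<^sup>+t. (v (f t) + u (f t)) * ennreal \<bar>d t\<bar> \<partial>lebesgue_on {0..})"
      using add(1,3) by (subst nn_integral_add[symmetric]) (auto simp: distrib_right)
    finally show ?case .
  next
    case (seq U)
    have [measurable]: "\<And>i. U i \<in> borel_measurable borel" using seq by auto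
    have "(\<integral>\<^sup>+s. indicator (f ` {0..}) s * (SUP i. U i) s \<partial>lborel)
        = (\<integral>\<^sup>+s. (SUP i. indicator (f ` {0..}) s * U i s) \<partial>lborel)"
      by (simp add: SUP_mult_left_ennreal image_comp)
    also have "\<dots> = (SUP i. \<integral>\<^sup>+s. indicator (f ` {0..}) s * U i s \<partial>lborel)"
      using \<open>incseq U\<close> by (intro nn_integral_monotone_convergence_SUP)
         (auto simp: incseq_def le_fun_def intro!: mult_left_mono)
    also have "\<dots> \<le> (\<integral>\<^sup>+t. (SUP i. U i) (f t) * ennreal \<bar>d t\<bar> \<partial>lebesgue_on {0..})"
    proof (rule SUP_least)
      fix i
      have "(\<integral>\<^sup>+t. U i (f t) * ennreal \<bar>d t\<bar> \<partial>lebesgue_on {0..})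
        \<le> (\<integral>\<^sup>+t. (SUP i. U i) (f t) * ennreal \<bar>d t\<bar> \<partial>lebesgue_on {0..})"
        by (intro nn_integral_mono mult_right_mono) (auto simp: image_comp intro!: SUP_upper)
      with seq.IH[of i] show "(\<integral>\<^sup>+s. indicator (f ` {0..}) s * U i s \<partial>lborel)
         \<le> (\<integral>\<^sup>+t. (SUP i. U i) (f t) * ennreal \<bar>d t\<bar> \<partial>lebesgue_on {0..})" by simp
    qed
    finally show ?case .
  }
qed

section \<open>Measurability of hitting sets\<close>

text \<open>The bound \<open>k\<close> is chosen before the accuracy \<open>j\<close>: the
  approximating times then lie in a compact interval and a subsequence converges to a hitting time,
  which excludes an approach to \<open>x\<close> only at infinity. Conversely
  \<open>t < real k\<close> leaves room for rationals just above \<open>t\<close>, even for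
  \<open>t = 0\<close>.\<close>

lemma hits_iff_rational_approach:
  fixes g :: "real \<Rightarrow> 'b::metric_space"
  assumes "continuous_on {0..} g"
  shows "(\<exists>t\<ge>0. g t = x) \<longleftrightarrow>
    (\<exists>k::nat. \<forall>j::nat. \<exists>q\<in>{0..real k} \<inter> \<rat>. dist (g q) x < inverse (real (Suc j)))"
proof
  assume "\<exists>t\<ge>0. g t = x"
  then obtain t where t: "0 \<le> t" "g t = x" by auto
  obtain k :: nat where k: "t < real k" using reals_Archimedean2 by blast
  show "\<exists>k::nat. \<forall>j::nat. \<exists>q\<in>{0..real k} \<inter> \<rat>. dist (g q) x < inverse (real (Suc j))"
  proof (intro exI[of _ k] allI)
    fix j :: nat
    obtain d where d: "d > 0" "\<And>q. 0 \<le> q \<Longrightarrow> dist q t < d \<Longrightarrow> dist (g q) (g t) < inverse (real (Suc j))"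
      using assms[unfolded continuous_on_iff, rule_format, of t "inverse (real (Suc j))"] t(1) by auto
    obtain q where "q \<in> \<rat>" "t < q" "q < min (t + d) (real k)"
      using Rats_dense_in_real[of t "min (t + d) (real k)"] k d(1) by auto
    then show "\<exists>q\<in>{0..real k} \<inter> \<rat>. dist (g q) x < inverse (real (Suc j))"
      using d(2)[of q] t by (intro bexI[of _ q]) (auto simp: dist_real_def)
  qed
next
  assume "\<exists>k::nat. \<forall>j::nat. \<exists>q\<in>{0..real k} \<inter> \<rat>. dist (g q) x < inverse (real (Suc j))"
  then obtain k :: nat and q where q: "\<And>j. q j \<in> {0..real k}" "\<And>j. dist (g (q j)) x < inverse (real (Suc j))"
    by (metis IntE)
  have "compact {0..real k}" by simp
  then obtain t r where t: "t \<in> {0..real k}" "strict_mono r" "(q \<circ> r) \<longlonglongrightarrow> t"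
    using q(1) unfolding compact_def by metis
  have "(\<lambda>j. g ((q \<circ> r) j)) \<longlonglongrightarrow> g t"
    using q(1) t by (intro continuous_on_tendsto_compose[OF assms]) (auto simp: o_def)
  moreover have "(\<lambda>j. g ((q \<circ> r) j)) \<longlonglongrightarrow> x"
  proof -
    have "(\<lambda>j. dist (g (q j)) x) \<longlonglongrightarrow> 0"
      by (rule tendsto_sandwich[OF _ _ tendsto_const LIMSEQ_inverse_real_of_nat])
         (use q(2) in \<open>auto intro!: always_eventually less_imp_le\<close>)
    then have "(\<lambda>j. g (q j)) \<longlonglongrightarrow> x" by (subst tendsto_dist_iff)
    from LIMSEQ_subseq_LIMSEQ[OF this t(2)] show ?thesis by (simp add: o_def)
  qed
  ultimately have "g t = x" by (rule LIMSEQ_unique)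
  then show "\<exists>t\<ge>0. g t = x" using t(1) by auto
qed

text \<open>Joint measurability in the target and the particle is what Tonelli's theorem needs
  later. Continuity in time reduces it to countably many time slices.\<close>

lemma sets_pair_hits:
  fixes g :: "'a \<Rightarrow> real \<Rightarrow> 'b::{second_countable_topology, metric_space}"
  assumes cont: "\<And>\<xi>. \<xi> \<in> space N \<Longrightarrow> continuous_on {0..} (g \<xi>)"
    and meas: "\<And>q. 0 \<le> q \<Longrightarrow> (\<lambda>\<xi>. g \<xi> q) \<in> borel_measurable N"
  shows "{p \<in> space (borel \<Otimes>\<^sub>M N). \<exists>t\<ge>0. g (snd p) t = fst p} \<in> sets (borel \<Otimes>\<^sub>M N)"
proof -
  have "{p \<in> space (borel \<Otimes>\<^sub>M N). \<exists>t\<ge>0. g (snd p) t = fst p} =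
    {p \<in> space (borel \<Otimes>\<^sub>M N). \<exists>k::nat. \<forall>j::nat. \<exists>q\<in>{0..real k} \<inter> \<rat>.
        dist (g (snd p) q) (fst p) < inverse (real (Suc j))}"
    by (intro Collect_cong conj_cong refl hits_iff_rational_approach cont) (auto simp: space_pair_measure)
  also have "\<dots> \<in> sets (borel \<Otimes>\<^sub>M N)"
  proof (intro sets.sets_Collect_countable_Ex sets.sets_Collect_countable_All sets.sets_Collect_countable_Ex')
    fix k j :: nat and q assume "q \<in> {0..real k} \<inter> \<rat>"
    then have [measurable]: "(\<lambda>\<xi>. g \<xi> q) \<in> borel_measurable N" using meas by auto
    show "{p \<in> space (borel \<Otimes>\<^sub>M N). dist (g (snd p) q) (fst p) < inverse (real (Suc j))} \<in> sets (borel \<Otimes>\<^sub>M N)"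
      by measurable
  qed (auto intro: countable_subset[OF _ countable_rat])
  finally show ?thesis .
qed

section \<open>Irrigation plans\<close>

locale irrigated_measure =
  fixes \<mu> :: "(real^2) measure" and \<gamma> :: "real \<Rightarrow> real \<Rightarrow> real^2" and T :: "real \<Rightarrow> real"
  assumes finite: "finite_measure \<mu>" and sets_\<mu>: "sets \<mu> = sets borel"
    and plan: "irrigation_plan \<mu> \<gamma> T"
begin

abbreviation M :: real where "M \<equiv> total_mass \<mu>"
abbreviation particles :: "real measure" where "particles \<equiv> lebesgue_on {0..M}"
abbreviation times :: "real measure" where "times \<equiv> lebesgue_on {0..}"

text \<open>A limit along the fixed steps 1/(k+1) is a total function, and jointly measurable even
  where the path has no derivative. Forward steps keep the times nonnegative.\<close>

definition velocity :: "real \<Rightarrow> real \<Rightarrow> real^2" where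
  "velocity \<xi> t = lim (\<lambda>k. real (Suc k) *\<^sub>R (\<gamma> \<xi> (t + inverse (real (Suc k))) - \<gamma> \<xi> t))"

lemma finite_particles: "finite_measure particles"
  by (rule finite_measure_lebesgue_on) simp

lemma sigma_finite_times: "sigma_finite_measure times"
proof (rule sigma_finite_measure_restrict_space)
  show "sigma_finite_measure (lebesgue :: real measure)"
  proof
    obtain A :: "real set set" where A: "countable A" "A \<subseteq> sets lborel" "\<Union> A = space lborel"
      "\<forall>a\<in>A. emeasure lborel a \<noteq> \<infinity>"
      using lborel.sigma_finite_countable[where 'a=real] by metis
    show "\<exists>A. countable A \<and> A \<subseteq> sets (lebesgue :: real measure) \<and> \<Union> A = space lebesgue \<and>
      (\<forall>a\<in>A. emeasure lebesgue a \<noteq> \<infinity>)"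
    proof (intro exI[of _ A] conjI ballI)
      fix a assume "a \<in> A"
      then have "a \<in> sets lborel" using A(2) by blast
      then have "emeasure lebesgue a = emeasure lborel a" by simp
      then show "emeasure lebesgue a \<noteq> \<infinity>" using A(4) \<open>a \<in> A\<close> by simp
    next
      show "countable A" by (rule A)
      show "A \<subseteq> sets lebesgue" using A(2) sets_completionI_sets by blast
      show "\<Union> A = space lebesgue" using A(3) by simp
    qed
  qed
qed simp

lemma measurable_path: "(\<lambda>(\<xi>, t). \<gamma> \<xi> t) \<in> borel_measurable (particles \<Otimes>\<^sub>M times)"
  using plan by (simp add: irrigation_plan_def)

lemma measurable_path_time:
  assumes "0 \<le> t"
  shows "(\<lambda>\<xi>. \<gamma> \<xi> t) \<in> borel_measurable particles"
  using measurable_compose[OF measurable_Pair2'[of t times particles] measurable_path] assms by simp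

lemma lipschitz_path:
  assumes "\<xi> \<in> {0..M}"
  obtains C where "C-lipschitz_on {0..} (\<gamma> \<xi>)"
  using plan assms unfolding irrigation_plan_def by blast

lemma continuous_path: "\<xi> \<in> {0..M} \<Longrightarrow> continuous_on {0..} (\<gamma> \<xi>)"
  by (metis lipschitz_path lipschitz_on_continuous_on)

lemma velocity_eqI:
  assumes "(\<gamma> \<xi> has_vector_derivative v) (at t)"
  shows "velocity \<xi> t = v"
proof -
  define h where "h k = inverse (real (Suc k))" for k
  have h: "0 < h k" for k by (simp add: h_def)
  have "filterlim h (at 0) sequentially"
    unfolding filterlim_at using LIMSEQ_inverse_real_of_nat h
    by (auto simp: h_def[abs_def] simp del: of_nat_Suc intro!: always_eventually)
  moreover have "(\<lambda>h. norm (\<gamma> \<xi> (t + h) - \<gamma> \<xi> t - h *\<^sub>R v) / norm h) \<midarrow>0\<rightarrow> 0"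
    using assms unfolding has_vector_derivative_def has_derivative_at by (rule conjunct2)
  ultimately have "(\<lambda>k. norm (\<gamma> \<xi> (t + h k) - \<gamma> \<xi> t - h k *\<^sub>R v) / norm (h k)) \<longlonglongrightarrow> 0"
    by (rule filterlim_compose[rotated])
  also have "(\<lambda>k. norm (\<gamma> \<xi> (t + h k) - \<gamma> \<xi> t - h k *\<^sub>R v) / norm (h k))
    = (\<lambda>k. norm (real (Suc k) *\<^sub>R (\<gamma> \<xi> (t + h k) - \<gamma> \<xi> t) - v))"
  proof
    fix k
    have "norm (\<gamma> \<xi> (t + h k) - \<gamma> \<xi> t - h k *\<^sub>R v) / norm (h k)
      = norm (inverse (h k) *\<^sub>R (\<gamma> \<xi> (t + h k) - \<gamma> \<xi> t - h k *\<^sub>R v))"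
      using h[of k] by (simp add: divide_inverse)
    also have "inverse (h k) *\<^sub>R (\<gamma> \<xi> (t + h k) - \<gamma> \<xi> t - h k *\<^sub>R v)
      = real (Suc k) *\<^sub>R (\<gamma> \<xi> (t + h k) - \<gamma> \<xi> t) - v"
      using h[of k] by (simp add: scaleR_diff_right[of _ _ "_ *\<^sub>R v"] del: of_nat_Suc) (simp add: h_def del: of_nat_Suc)
    finally show "norm (\<gamma> \<xi> (t + h k) - \<gamma> \<xi> t - h k *\<^sub>R v) / norm (h k)
      = norm (real (Suc k) *\<^sub>R (\<gamma> \<xi> (t + h k) - \<gamma> \<xi> t) - v)" .
  qed
  finally have "(\<lambda>k. real (Suc k) *\<^sub>R (\<gamma> \<xi> (t + inverse (real (Suc k))) - \<gamma> \<xi> t)) \<longlonglongrightarrow> v"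
    unfolding h_def by (subst Lim_null) (rule tendsto_norm_zero_cancel)
  then show ?thesis unfolding velocity_def by (rule limI)
qed

text \<open>The speed is the indicator of the travelling time. An integral up to
  \<open>T \<xi>\<close> thus becomes an integral over all times with a jointly measurable
  integrand, although \<open>T\<close> itself need not be measurable.\<close>

lemma AE_velocity:
  assumes \<xi>: "\<xi> \<in> {0..M}"
  shows "AE t in times. (\<gamma> \<xi> has_vector_derivative velocity \<xi> t) (at t) \<and>
    norm (velocity \<xi> t) = indicator {0..T \<xi>} t"
proof -
  have "AE t in lebesgue_on {0..T \<xi>}. \<exists>v. (\<gamma> \<xi> has_vector_derivative v) (at t) \<and> norm v = 1"
    and stop: "\<And>t. t > T \<xi> \<Longrightarrow> (\<gamma> \<xi> has_vector_derivative 0) (at t)"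
    using plan \<xi> by (auto simp: irrigation_plan_def)
  then have "AE t in lebesgue. t \<in> {0..T \<xi>} \<longrightarrow> (\<exists>v. (\<gamma> \<xi> has_vector_derivative v) (at t) \<and> norm v = 1)"
    by (subst (asm) AE_restrict_space_iff) auto
  then have "AE t in lebesgue. t \<in> {0..} \<longrightarrow> (\<gamma> \<xi> has_vector_derivative velocity \<xi> t) (at t) \<and>
    norm (velocity \<xi> t) = indicator {0..T \<xi>} t"
  proof (rule AE_mp, intro AE_I2 impI)
    fix t :: real
    assume *: "t \<in> {0..T \<xi>} \<longrightarrow> (\<exists>v. (\<gamma> \<xi> has_vector_derivative v) (at t) \<and> norm v = 1)" and "t \<in> {0..}"
    show "(\<gamma> \<xi> has_vector_derivative velocity \<xi> t) (at t) \<and> norm (velocity \<xi> t) = indicator {0..T \<xi>} t"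
    proof (cases "t \<le> T \<xi>")
      case True
      with * \<open>t \<in> {0..}\<close> obtain v where "(\<gamma> \<xi> has_vector_derivative v) (at t)" "norm v = 1" by auto
      with velocity_eqI[OF this(1)] True \<open>t \<in> {0..}\<close> show ?thesis by auto
    next
      case False
      with velocity_eqI[OF stop[of t]] stop[of t] show ?thesis by auto
    qed
  qed
  then show ?thesis by (subst AE_restrict_space_iff) auto
qed

lemma measurable_velocity: "(\<lambda>(\<xi>, t). velocity \<xi> t) \<in> borel_measurable (particles \<Otimes>\<^sub>M times)"
proof -
  note measurable_path[measurable]
  \<comment> \<open>On the completed measure space continuity does not give measurability, since
    preimages of arbitrary null sets are involved; an affine bijection is Lebesgue-to-Lebesgue
    measurable.\<close>
  have shift: "(\<lambda>t. t + h) \<in> measurable times times" if "0 \<le> h" for h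
  proof (rule measurable_restrict_space3)
    have "(\<lambda>t. h + (\<Sum>j\<in>Basis. (1 * (t \<bullet> j)) *\<^sub>R j)) \<in> lebesgue \<rightarrow>\<^sub>M lebesgue"
      by (rule lebesgue_affine_measurable) auto
    then show "(\<lambda>t. t + h) \<in> lebesgue \<rightarrow>\<^sub>M lebesgue" by (simp add: add.commute)
  qed (use that in auto)
  have later: "(\<lambda>p. \<gamma> (fst p) (snd p + h)) \<in> borel_measurable (particles \<Otimes>\<^sub>M times)" if "0 \<le> h" for h
  proof -
    note shift[OF that, measurable]
    have "(\<lambda>p. (fst p, snd p + h)) \<in> measurable (particles \<Otimes>\<^sub>M times) (particles \<Otimes>\<^sub>M times)"
      by measurable
    from measurable_compose[OF this measurable_path] show ?thesis by simp
  qed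
  have "(\<lambda>p. velocity (fst p) (snd p)) \<in> borel_measurable (particles \<Otimes>\<^sub>M times)"
    unfolding velocity_def
  proof (rule borel_measurable_lim_metric)
    fix k
    have "(\<lambda>p. \<gamma> (fst p) (snd p)) \<in> borel_measurable (particles \<Otimes>\<^sub>M times)"
      using later[of 0] by simp
    moreover note later[of "inverse (real (Suc k))"]
    ultimately show "(\<lambda>p. real (Suc k) *\<^sub>R (\<gamma> (fst p) (snd p + inverse (real (Suc k))) - \<gamma> (fst p) (snd p)))
        \<in> borel_measurable (particles \<Otimes>\<^sub>M times)"
      by simp
  qed
  then show ?thesis by (simp add: split_beta')
qed

lemma path_after_stop:
  assumes \<xi>: "\<xi> \<in> {0..M}" and t: "T \<xi> \<le> t"
  shows "\<gamma> \<xi> t = \<gamma> \<xi> (T \<xi>)"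
proof (rule has_derivative_zero_unique_strong_interval[where k="{T \<xi>}" and a="T \<xi>" and b=t])
  have T: "0 \<le> T \<xi>" "\<And>t. t > T \<xi> \<Longrightarrow> (\<gamma> \<xi> has_vector_derivative 0) (at t)"
    using plan \<xi> by (auto simp: irrigation_plan_def)
  show "continuous_on {T \<xi>..t} (\<gamma> \<xi>)"
    by (rule continuous_on_subset[OF continuous_path[OF \<xi>]]) (use T in auto)
  show "(\<gamma> \<xi> has_derivative (\<lambda>h. 0)) (at x within {T \<xi>..t})" if "x \<in> {T \<xi>..t} - {T \<xi>}" for x
    using T(2)[of x] that by (auto simp: has_vector_derivative_def intro: has_derivative_at_withinI)
qed (use t in auto)

text \<open>Substituting \<open>T \<xi>\<close> for the time would require \<open>T\<close> to be
  measurable. After stopping the path is constant, so the endpoint is the eventual value along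
  integer times.\<close>

lemma measurable_endpoint: "(\<lambda>\<xi>. \<gamma> \<xi> (T \<xi>)) \<in> borel_measurable particles"
proof (rule borel_measurable_LIMSEQ_metric)
  show "(\<lambda>\<xi>. \<gamma> \<xi> (real k)) \<in> borel_measurable particles" for k
    by (rule measurable_path_time) simp
  show "(\<lambda>k. \<gamma> \<xi> (real k)) \<longlonglongrightarrow> \<gamma> \<xi> (T \<xi>)" if "\<xi> \<in> space particles" for \<xi>
  proof (rule tendsto_eventually)
    have "\<forall>\<^sub>F k in sequentially. T \<xi> \<le> real k"
      using eventually_ge_at_top[of "nat \<lceil>T \<xi>\<rceil>"] by eventually_elim linarith
    then show "\<forall>\<^sub>F k in sequentially. \<gamma> \<xi> (real k) = \<gamma> \<xi> (T \<xi>)"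
      by eventually_elim (use that in \<open>auto intro: path_after_stop\<close>)
  qed
qed

lemma distr_endpoint: "distr particles borel (\<lambda>\<xi>. \<gamma> \<xi> (T \<xi>)) = \<mu>"
  using plan by (simp add: irrigation_plan_def)

lemma stop_nonneg: "\<xi> \<in> {0..M} \<Longrightarrow> 0 \<le> T \<xi>"
  using plan by (simp add: irrigation_plan_def)

lemma start: "\<xi> \<in> {0..M} \<Longrightarrow> \<gamma> \<xi> 0 = 0"
  using plan by (simp add: irrigation_plan_def)

end

section \<open>Masses crossing a level, and the cost estimate in one direction\<close>

lemma ennreal_inverse_antimono: "a \<le> b \<Longrightarrow> inverse b \<le> inverse (a :: ennreal)"
  by (cases a; cases b; cases "a = 0") (auto simp: inverse_ennreal ennreal_le_iff2 top_unique ennreal_neg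
     intro!: ennreal_leI)

lemma flux_weight_0_inverse: "0 \<le> m \<Longrightarrow> flux_weight 0 m = inverse (ennreal m)"
  by (auto simp: flux_weight_def powr_minus inverse_ennreal)

context irrigated_measure
begin

lemma sets_hits:
  fixes p :: "real^2 \<Rightarrow> 'b::{second_countable_topology, metric_space}"
  assumes "continuous_on UNIV p"
  shows "{q \<in> space (borel \<Otimes>\<^sub>M particles). \<exists>t\<ge>0. p (\<gamma> (snd q) t) = fst q} \<in> sets (borel \<Otimes>\<^sub>M particles)"
proof (rule sets_pair_hits)
  have [measurable]: "p \<in> borel_measurable borel" using assms by (rule borel_measurable_continuous_onI)
  show "continuous_on {0..} (\<lambda>t. p (\<gamma> \<xi> t))" if "\<xi> \<in> space particles" for \<xi>
    using continuous_on_compose2[OF assms continuous_path] that by simp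
  show "(\<lambda>\<xi>. p (\<gamma> \<xi> t)) \<in> borel_measurable particles" if "0 \<le> t" for t
    using measurable_path_time[OF that] by measurable
qed

text \<open>One notion for two quantities: with the identity for \<open>p\<close> it is the flux,
  with the inner product with a fixed vector it is the mass \<open>m\<close> of the
  overview.\<close>

definition hit_mass :: "(real^2 \<Rightarrow> 'b) \<Rightarrow> 'b \<Rightarrow> real" where
  "hit_mass p x = measure lebesgue {\<xi> \<in> {0..M}. \<exists>t\<ge>0. p (\<gamma> \<xi> t) = x}"

lemma flux_eq_hit_mass: "flux M \<gamma> = hit_mass (\<lambda>x. x)"
  by (rule ext) (simp add: flux_def hit_mass_def)

context
  fixes p :: "real^2 \<Rightarrow> 'b::{second_countable_topology, metric_space}"
  assumes p: "continuous_on UNIV p"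
begin

lemma hits_lmeasurable: "{\<xi> \<in> {0..M}. \<exists>t\<ge>0. p (\<gamma> \<xi> t) = x} \<in> lmeasurable"
proof (rule bounded_set_imp_lmeasurable)
  have "Pair x -` {q \<in> space (borel \<Otimes>\<^sub>M particles). \<exists>t\<ge>0. p (\<gamma> (snd q) t) = fst q} \<in> sets particles"
    by (rule sets_Pair1[OF sets_hits[OF p]])
  also have "Pair x -` {q \<in> space (borel \<Otimes>\<^sub>M particles). \<exists>t\<ge>0. p (\<gamma> (snd q) t) = fst q}
    = {\<xi> \<in> {0..M}. \<exists>t\<ge>0. p (\<gamma> \<xi> t) = x}" by (auto simp: space_pair_measure)
  finally show "{\<xi> \<in> {0..M}. \<exists>t\<ge>0. p (\<gamma> \<xi> t) = x} \<in> sets lebesgue"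
    by (subst (asm) sets_restrict_space_iff) auto
qed (auto intro: bounded_subset[of "{0..M}"])

lemma emeasure_hits:
  "emeasure particles {\<xi> \<in> {0..M}. \<exists>t\<ge>0. p (\<gamma> \<xi> t) = x} = ennreal (hit_mass p x)"
  using hits_lmeasurable[of x]
  by (subst emeasure_restrict_space) (auto simp: hit_mass_def emeasure_eq_measure2)

lemma hit_mass_nonneg: "0 \<le> hit_mass p x"
  by (simp add: hit_mass_def)

lemma measurable_hit_mass: "hit_mass p \<in> borel_measurable borel"
proof -
  interpret finite_measure particles by (rule finite_particles)
  have "(\<lambda>x. emeasure particles (Pair x -` {q \<in> space (borel \<Otimes>\<^sub>M particles). \<exists>t\<ge>0. p (\<gamma> (snd q) t) = fst q}))
    \<in> borel_measurable borel"
    by (rule measurable_emeasure_Pair[OF sets_hits[OF p]])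
  also have "(\<lambda>x. emeasure particles (Pair x -` {q \<in> space (borel \<Otimes>\<^sub>M particles). \<exists>t\<ge>0. p (\<gamma> (snd q) t) = fst q}))
    = (\<lambda>x. ennreal (hit_mass p x))"
    by (rule ext, subst emeasure_hits[symmetric], rule arg_cong[where f="emeasure particles"])
      (auto simp: space_pair_measure)
  finally have "(\<lambda>x. enn2real (ennreal (hit_mass p x))) \<in> borel_measurable borel" by measurable
  then show ?thesis by (simp add: hit_mass_nonneg)
qed

text \<open>A particle through \<open>x\<close> also meets the level \<open>p x\<close>; this
  replaces the flux by a function of the level alone.\<close>

lemma flux_le_hit_mass: "flux M \<gamma> x \<le> hit_mass p (p x)"
proof -
  have "{\<xi> \<in> {0..M}. \<exists>t\<ge>0. \<gamma> \<xi> t = x} \<in> sets lebesgue"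
  proof -
    have "Pair x -` {q \<in> space (borel \<Otimes>\<^sub>M particles). \<exists>t\<ge>0. \<gamma> (snd q) t = fst q} \<in> sets particles"
      using sets_Pair1[OF sets_hits[OF continuous_on_id]] by simp
    also have "Pair x -` {q \<in> space (borel \<Otimes>\<^sub>M particles). \<exists>t\<ge>0. \<gamma> (snd q) t = fst q}
      = {\<xi> \<in> {0..M}. \<exists>t\<ge>0. \<gamma> \<xi> t = x}" by (auto simp: space_pair_measure)
    finally show ?thesis by (subst (asm) sets_restrict_space_iff) auto
  qed
  then show ?thesis
    unfolding flux_def hit_mass_def by (intro measure_mono_fmeasurable hits_lmeasurable) auto
qed

end

lemma measurable_flux_weight:
  "(\<lambda>(\<xi>, t). flux_weight 0 (flux M \<gamma> (\<gamma> \<xi> t))) \<in> borel_measurable (particles \<Otimes>\<^sub>M times)"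
proof -
  note measurable_hit_mass[OF continuous_on_id, measurable] measurable_path[measurable]
  have "(\<lambda>q. inverse (ennreal (hit_mass (\<lambda>x. x) (\<gamma> (fst q) (snd q))))) \<in> borel_measurable (particles \<Otimes>\<^sub>M times)"
    using measurable_path by (simp add: split_beta')
  then show ?thesis
    by (simp add: flux_eq_hit_mass flux_weight_0_inverse hit_mass_nonneg[OF continuous_on_id] split_beta')
qed

lemma shadow_le_projected_cost:
  "emeasure lborel {s. hit_mass (\<lambda>x. x \<bullet> v) s > 0}
    \<le> (\<integral>\<^sup>+\<xi>. \<integral>\<^sup>+t. flux_weight 0 (flux M \<gamma> (\<gamma> \<xi> t)) * ennreal \<bar>velocity \<xi> t \<bullet> v\<bar> \<partial>times \<partial>particles)"
proof -
  let ?m = "hit_mass (\<lambda>x. x \<bullet> v)"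
  let ?f = "\<lambda>\<xi> t. \<gamma> \<xi> t \<bullet> v"
  let ?hit = "{q \<in> space (borel \<Otimes>\<^sub>M particles). \<exists>t\<ge>0. \<gamma> (snd q) t \<bullet> v = fst q}"
  have p: "continuous_on UNIV (\<lambda>x. x \<bullet> v)" by (intro continuous_intros)
  note measurable_hit_mass[OF p, measurable]
  interpret finite_measure particles by (rule finite_particles)
  interpret P: pair_sigma_finite lborel particles ..
  have hit[measurable]: "?hit \<in> sets (lborel \<Otimes>\<^sub>M particles)"
    using sets_hits[OF p] by (simp cong: sets_pair_measure_cong)
  have ind: "indicator ?hit (s, \<xi>) = (indicator (?f \<xi> ` {0..}) s :: ennreal)" if "\<xi> \<in> space particles" for s \<xi>
    using that by (auto simp: indicator_def space_pair_measure)
  have "emeasure lborel {s. ?m s > 0} = (\<integral>\<^sup>+s. indicator {s. ?m s > 0} s \<partial>lborel)"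
    by (subst nn_integral_indicator) auto
  \<comment> \<open>In \<open>ennreal\<close> the inverse of 0 is infinite and infinity times 0 is
    0, so the product is exactly the indicator of positive mass.\<close>
  also have "\<dots> = (\<integral>\<^sup>+s. inverse (ennreal (?m s)) * ennreal (?m s) \<partial>lborel)"
    by (intro nn_integral_cong)
      (auto simp: indicator_def not_less inverse_ennreal ennreal_neg hit_mass_nonneg[OF p] simp flip: ennreal_mult)
  also have "\<dots> = (\<integral>\<^sup>+s. \<integral>\<^sup>+\<xi>. inverse (ennreal (?m s)) * indicator ?hit (s, \<xi>) \<partial>particles \<partial>lborel)"
  proof (intro nn_integral_cong)
    fix s
    define H where "H = {\<xi> \<in> {0..M}. \<exists>t\<ge>0. \<gamma> \<xi> t \<bullet> v = s}"
    have H[measurable]: "H \<in> sets particles"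
      using hits_lmeasurable[OF p, of s] by (subst sets_restrict_space_iff) (auto simp: H_def)
    have "(\<integral>\<^sup>+\<xi>. inverse (ennreal (?m s)) * indicator ?hit (s, \<xi>) \<partial>particles)
        = (\<integral>\<^sup>+\<xi>. inverse (ennreal (?m s)) * indicator H \<xi> \<partial>particles)"
      by (intro nn_integral_cong) (auto simp: indicator_def space_pair_measure H_def)
    also have "\<dots> = inverse (ennreal (?m s)) * emeasure particles H"
      by (rule nn_integral_cmult_indicator[OF H])
    finally show "inverse (ennreal (?m s)) * ennreal (?m s)
        = (\<integral>\<^sup>+\<xi>. inverse (ennreal (?m s)) * indicator ?hit (s, \<xi>) \<partial>particles)"
      using emeasure_hits[OF p, of s] by (simp add: H_def)
  qed
  \<comment> \<open>Regrouped by particles: each one pays 1/m for every level in the image of its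
    projected path, once per level, which is the left side of the image inequality.\<close>
  also have "\<dots> = (\<integral>\<^sup>+\<xi>. \<integral>\<^sup>+s. inverse (ennreal (?m s)) * indicator ?hit (s, \<xi>) \<partial>lborel \<partial>particles)"
    by (rule P.Fubini'[symmetric]) simp
  also have "\<dots> \<le> (\<integral>\<^sup>+\<xi>. \<integral>\<^sup>+t. flux_weight 0 (flux M \<gamma> (\<gamma> \<xi> t)) * ennreal \<bar>velocity \<xi> t \<bullet> v\<bar> \<partial>times \<partial>particles)"
  proof (intro nn_integral_mono)
    fix \<xi> assume \<xi>: "\<xi> \<in> space particles"
    then have \<xi>': "\<xi> \<in> {0..M}" by simp
    obtain C where C: "C-lipschitz_on {0..} (\<gamma> \<xi>)" by (rule lipschitz_path[OF \<xi>'])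
    have "(\<integral>\<^sup>+s. inverse (ennreal (?m s)) * indicator ?hit (s, \<xi>) \<partial>lborel)
        = (\<integral>\<^sup>+s. indicator (?f \<xi> ` {0..}) s * inverse (ennreal (?m s)) \<partial>lborel)"
      using ind[OF \<xi>] by (simp add: mult.commute)
    also have "\<dots> \<le> (\<integral>\<^sup>+t. inverse (ennreal (?m (?f \<xi> t))) * ennreal \<bar>velocity \<xi> t \<bullet> v\<bar> \<partial>times)"
    proof (rule Lipschitz_image_nn_integral_le)
      show "(C * norm v)-lipschitz_on {0..} (?f \<xi>)"
      proof (rule lipschitz_onI)
        fix x y :: real assume "x \<in> {0..}" "y \<in> {0..}"
        have "dist (?f \<xi> x) (?f \<xi> y) \<le> norm (\<gamma> \<xi> x - \<gamma> \<xi> y) * norm v"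
          using Cauchy_Schwarz_ineq2[of "\<gamma> \<xi> x - \<gamma> \<xi> y" v] by (simp add: dist_real_def inner_diff_left)
        also have "\<dots> \<le> C * dist x y * norm v"
          using lipschitz_onD[OF C \<open>x \<in> _\<close> \<open>y \<in> _\<close>] by (intro mult_right_mono) (auto simp: dist_norm)
        finally show "dist (?f \<xi> x) (?f \<xi> y) \<le> C * norm v * dist x y" by (simp add: mult_ac)
      qed (use lipschitz_on_nonneg[OF C] in simp)
      show "AE t in times. (?f \<xi> has_real_derivative velocity \<xi> t \<bullet> v) (at t)"
        using AE_velocity[OF \<xi>']
      proof eventually_elim
        case (elim t)
        then have "((\<lambda>t. ?f \<xi> t) has_vector_derivative velocity \<xi> t \<bullet> v) (at t)"
          by (intro bounded_linear.has_vector_derivative[OF bounded_linear_inner_left]) simp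
        then show ?case by (simp add: has_real_derivative_iff_has_vector_derivative)
      qed
      have "(\<lambda>t. velocity \<xi> t) \<in> borel_measurable times"
        using measurable_compose[OF measurable_Pair1'[OF \<xi>] measurable_velocity] by simp
      then show "(\<lambda>t. velocity \<xi> t \<bullet> v) \<in> borel_measurable times" by measurable
    qed simp
    \<comment> \<open>The flux is at most the mass of its level, and the weight decreases in the
      flux.\<close>
    also have "\<dots> \<le> (\<integral>\<^sup>+t. flux_weight 0 (flux M \<gamma> (\<gamma> \<xi> t)) * ennreal \<bar>velocity \<xi> t \<bullet> v\<bar> \<partial>times)"
    proof (intro nn_integral_mono mult_right_mono)
      fix t
      have "flux_weight 0 (flux M \<gamma> (\<gamma> \<xi> t)) = inverse (ennreal (flux M \<gamma> (\<gamma> \<xi> t)))"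
        by (simp add: flux_weight_0_inverse flux_def)
      moreover have "ennreal (flux M \<gamma> (\<gamma> \<xi> t)) \<le> ennreal (?m (?f \<xi> t))"
        using flux_le_hit_mass[OF p] by (rule ennreal_leI)
      ultimately show "inverse (ennreal (?m (?f \<xi> t))) \<le> flux_weight 0 (flux M \<gamma> (\<gamma> \<xi> t))"
        by (simp add: ennreal_inverse_antimono)
    qed simp
    finally show "(\<integral>\<^sup>+s. inverse (ennreal (?m s)) * indicator ?hit (s, \<xi>) \<partial>lborel)
      \<le> (\<integral>\<^sup>+t. flux_weight 0 (flux M \<gamma> (\<gamma> \<xi> t)) * ennreal \<bar>velocity \<xi> t \<bullet> v\<bar> \<partial>times)" .
  qed
  finally show ?thesis .
qed

end

section \<open>Projections\<close>

definition rot90 :: "real^2 \<Rightarrow> real^2" where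
  "rot90 n = vector [- n $ 2, n $ 1]"

lemma rot90_simps [simp]: "rot90 n $ 1 = - n $ 2" "rot90 n $ 2 = n $ 1"
  by (simp_all add: rot90_def)

lemma inner_real2: "(x :: real^2) \<bullet> y = x $ 1 * y $ 1 + x $ 2 * y $ 2"
  by (simp add: inner_vec_def sum_2)

lemma norm_rot90 [simp]: "norm (rot90 n) = norm n"
  by (simp add: norm_eq_sqrt_inner inner_real2)

lemma inner_rot90_self [simp]: "rot90 n \<bullet> n = 0"
  by (simp add: inner_real2)

text \<open>The quarter turn is skew-adjoint. This moves the rotation from the direction of light to
  the velocity, or to the direction of the segment, and so produces the integral that defines
  K.\<close>

lemma inner_rot90_right: "x \<bullet> rot90 n = - (rot90 x \<bullet> n)"
  by (simp add: inner_real2)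

lemma continuous_on_rot90: "continuous_on UNIV rot90"
proof -
  have *: "rot90 = (\<lambda>n. (- n $ 2) *\<^sub>R axis 1 1 + (n $ 1) *\<^sub>R axis 2 1)"
    by (rule ext) (simp add: vec_eq_iff forall_2 axis_def)
  show ?thesis by (subst *) (intro continuous_intros)
qed

lemma borel_measurable_rot90 [measurable]: "rot90 \<in> borel_measurable borel"
  by (rule borel_measurable_continuous_onI[OF continuous_on_rot90])

lemma perp_proj_eq:
  assumes "norm n = 1"
  shows "perp_proj n x = (x \<bullet> rot90 n) *\<^sub>R rot90 n"
proof -
  have n: "n $ 1 * n $ 1 + n $ 2 * n $ 2 = 1"
    using assms by (simp add: norm_eq_1 inner_real2)
  have "x $ 1 - (x $ 1 * n $ 1 + x $ 2 * n $ 2) * n $ 1 = - (x $ 2 * n $ 1 - x $ 1 * n $ 2) * n $ 2"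
    "x $ 2 - (x $ 1 * n $ 1 + x $ 2 * n $ 2) * n $ 2 = (x $ 2 * n $ 1 - x $ 1 * n $ 2) * n $ 1"
    using n by algebra+
  then show ?thesis
    by (simp add: perp_proj_def vec_eq_iff forall_2 inner_real2 algebra_simps)
qed

lemma perp_line_lebesgue_eq:
  "perp_line_lebesgue n = distr lborel (restrict_space borel (perp_line n)) (\<lambda>s. s *\<^sub>R rot90 n)"
  by (simp add: perp_line_lebesgue_def rot90_def)

lemma space_perp_line_lebesgue [simp]: "space (perp_line_lebesgue n) = perp_line n"
  by (simp add: perp_line_lebesgue_def space_restrict_space)

lemma sets_perp_line_lebesgue [simp, measurable_cong]:
  "sets (perp_line_lebesgue n) = sets (restrict_space borel (perp_line n))"
  by (simp add: perp_line_lebesgue_def)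

lemma measurable_scale_rot90:
  "(\<lambda>s. s *\<^sub>R rot90 n) \<in> measurable lborel (restrict_space borel (perp_line n))"
  by (rule measurable_restrict_space2) (auto simp: perp_line_def)

lemma nn_integral_perp_line_lebesgue:
  assumes "h \<in> borel_measurable (restrict_space borel (perp_line n))"
  shows "(\<integral>\<^sup>+y. h y \<partial>perp_line_lebesgue n) = (\<integral>\<^sup>+s. h (s *\<^sub>R rot90 n) \<partial>lborel)"
  unfolding perp_line_lebesgue_eq by (rule nn_integral_distr[OF measurable_scale_rot90]) (simp add: assms)

lemma measurable_inner_perp_line [measurable]:
  "(\<lambda>y. y \<bullet> v) \<in> borel_measurable (restrict_space borel (perp_line n))"
  by (rule measurable_restrict_space1) simp

lemma sets_perp_line_strip:
  assumes "Z \<in> sets borel"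
  shows "{y \<in> perp_line n. y \<bullet> v \<in> Z} \<in> sets (restrict_space borel (perp_line n))"
proof -
  have "{y \<in> perp_line n. y \<bullet> v \<in> Z} = (\<lambda>y. y \<bullet> v) -` Z \<inter> space (restrict_space borel (perp_line n))"
    by (auto simp: space_restrict_space)
  then show ?thesis using measurable_sets[OF measurable_inner_perp_line assms] by simp
qed

lemma emeasure_perp_line_lebesgue:
  assumes n: "norm n = 1" and Z: "Z \<in> sets borel"
  shows "emeasure (perp_line_lebesgue n) {y \<in> perp_line n. y \<bullet> rot90 n \<in> Z} = emeasure lborel Z"
proof -
  have "emeasure (perp_line_lebesgue n) {y \<in> perp_line n. y \<bullet> rot90 n \<in> Z}
     = emeasure lborel ((\<lambda>s. s *\<^sub>R rot90 n) -` {y \<in> perp_line n. y \<bullet> rot90 n \<in> Z} \<inter> space lborel)"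
    unfolding perp_line_lebesgue_eq
    by (rule emeasure_distr[OF measurable_scale_rot90 sets_perp_line_strip[OF Z]])
  also have "(\<lambda>s. s *\<^sub>R rot90 n) -` {y \<in> perp_line n. y \<bullet> rot90 n \<in> Z} \<inter> space lborel = Z"
    using n by (auto simp: perp_line_def norm_eq_1[of "rot90 n", symmetric] dot_square_norm)
  finally show ?thesis .
qed

lemma sigma_finite_perp_line_lebesgue:
  assumes n: "norm n = 1"
  shows "sigma_finite_measure (perp_line_lebesgue n)"
proof
  define A where "A k = {y \<in> perp_line n. y \<bullet> rot90 n \<in> {- real k..real k}}" for k
  have "A k \<in> sets (perp_line_lebesgue n)" for k
    unfolding A_def sets_perp_line_lebesgue by (rule sets_perp_line_strip) simp
  moreover have "(\<Union>k. A k) = perp_line n"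
  proof (intro equalityI subsetI)
    fix y assume y: "y \<in> perp_line n"
    obtain k :: nat where "\<bar>y \<bullet> rot90 n\<bar> \<le> real k" using real_arch_simple by blast
    then have "y \<in> A k" using y by (auto simp: A_def)
    then show "y \<in> (\<Union>k. A k)" by blast
  qed (auto simp: A_def)
  moreover have "emeasure (perp_line_lebesgue n) (A k) \<noteq> \<infinity>" for k
    unfolding A_def by (subst emeasure_perp_line_lebesgue[OF n]) auto
  ultimately show "\<exists>A. countable A \<and> A \<subseteq> sets (perp_line_lebesgue n) \<and> \<Union> A = space (perp_line_lebesgue n) \<and>
    (\<forall>a\<in>A. emeasure (perp_line_lebesgue n) a \<noteq> \<infinity>)"
    by (intro exI[of _ "range A"]) (auto simp del: sets_perp_line_lebesgue)
qed

section \<open>Light collected in one direction, and reduction to countably many levels\<close>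

lemma ac_part_eqI:
  assumes "lebesgue_decomposition L \<nu> a s"
  shows "ac_part L \<nu> = a"
  unfolding ac_part_def using assms lebesgue_decomposition_unique by (intro the_equality) blast+

lemma measurable_perp_proj:
  assumes "norm n = 1" "sets \<mu> = sets borel"
  shows "perp_proj n \<in> measurable \<mu> (restrict_space borel (perp_line n))"
proof (rule measurable_restrict_space2)
  show "perp_proj n \<in> space \<mu> \<rightarrow> perp_line n"
    using assms(1) by (auto simp: perp_proj_eq perp_line_def)
  show "perp_proj n \<in> measurable \<mu> borel"
    unfolding perp_proj_eq[OF assms(1), abs_def] using assms(2)
    by (subst measurable_cong_sets[OF assms(2) refl]) measurable
qed

text \<open>The absolutely continuous part is dominated by the projected measure, so its density
  vanishes almost everywhere over \<open>Z\<close>, where the integrand becomes 1 - exp 0 = 0.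
  Elsewhere the integrand is at most 1, whatever the density.\<close>

lemma shadow_le_of_null:
  assumes \<mu>: "finite_measure \<mu>" "sets \<mu> = sets borel" and n: "norm n = 1"
    and Z: "Z \<in> sets borel" "emeasure \<mu> {x. x \<bullet> rot90 n \<in> Z} = 0"
  shows "(\<integral>\<^sup>+y. ennreal (1 - exp (- projected_density \<mu> n y)) \<partial>perp_line_lebesgue n) \<le> emeasure lborel (- Z)"
proof -
  let ?L = "perp_line_lebesgue n" and ?\<nu> = "projected_measure n \<mu>"
  interpret L: sigma_finite_measure ?L by (rule sigma_finite_perp_line_lebesgue[OF n])
  have sets_\<nu>: "sets ?\<nu> = sets ?L" by (simp add: projected_measure_def)
  have "finite_measure ?\<nu>" unfolding projected_measure_def
    by (rule finite_measure.finite_measure_distr[OF \<mu>(1) measurable_perp_proj[OF n \<mu>(2)]])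
  then obtain a s where dec: "lebesgue_decomposition ?L ?\<nu> a s"
    using lebesgue_decomposition_exists[OF _ sets_\<nu>] by blast
  then have a: "sets a = sets ?L" "absolutely_continuous ?L a" by (auto simp: lebesgue_decomposition_def)
  define Z' where "Z' = {y \<in> perp_line n. y \<bullet> rot90 n \<in> Z}"
  have Z'_sets: "Z' \<in> sets (restrict_space borel (perp_line n))"
    unfolding Z'_def by (rule sets_perp_line_strip[OF Z(1)])
  then have Z'L: "Z' \<in> sets ?L" by simp
  have "emeasure ?\<nu> Z' = emeasure \<mu> (perp_proj n -` Z' \<inter> space \<mu>)"
    unfolding projected_measure_def by (rule emeasure_distr[OF measurable_perp_proj[OF n \<mu>(2)] Z'_sets])
  also have "perp_proj n -` Z' \<inter> space \<mu> = {x. x \<bullet> rot90 n \<in> Z}"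
    using n sets_eq_imp_space_eq[OF \<mu>(2)] by (auto simp: Z'_def perp_proj_eq perp_line_def dot_square_norm)
  finally have "emeasure ?\<nu> Z' = 0" using Z(2) by simp
  then have "emeasure a Z' = 0"
    using dec Z'L by (auto simp: lebesgue_decomposition_def)
  then have "emeasure (density ?L (RN_deriv ?L a)) Z' = 0"
    using L.density_RN_deriv[OF a(2,1)] by simp
  then have "AE y in ?L. RN_deriv ?L a y = 0 \<or> indicator Z' y = (0 :: ennreal)"
    using Z'L by (simp add: emeasure_density nn_integral_0_iff_AE del: sets_perp_line_lebesgue)
  then have "AE y in ?L. y \<in> Z' \<longrightarrow> RN_deriv ?L a y = 0"
    by eventually_elim (auto simp: indicator_def)
  with AE_space have "AE y in ?L. ennreal (1 - exp (- projected_density \<mu> n y)) \<le> indicator (perp_line n - Z') y"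
  proof eventually_elim
    case (elim y)
    then show ?case
      by (cases "y \<in> Z'") (simp_all add: projected_density_def ac_part_eqI[OF dec])
  qed
  then have "(\<integral>\<^sup>+y. ennreal (1 - exp (- projected_density \<mu> n y)) \<partial>?L) \<le> (\<integral>\<^sup>+y. indicator (perp_line n - Z') y \<partial>?L)"
    by (rule nn_integral_mono_AE)
  also have "\<dots> = emeasure ?L (perp_line n - Z')"
    using sets.compl_sets[OF Z'L] by (intro nn_integral_indicator) simp
  also have "perp_line n - Z' = {y \<in> perp_line n. y \<bullet> rot90 n \<in> - Z}" by (auto simp: Z'_def)
  also have "emeasure ?L \<dots> = emeasure lborel (- Z)"
    using Z(1) by (intro emeasure_perp_line_lebesgue[OF n]) (simp add: borel_comp)
  finally show ?thesis .
qed

text \<open>Below each rational that exceeds some element of \<open>U\<close> one element of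
  \<open>U\<close> is chosen. If \<open>u\<close> is not minimal, a rational fits between a smaller
  element and \<open>u\<close>; only a minimum of \<open>U\<close> can be missed, and it is added by
  hand.\<close>

lemma countable_coinitial_subset:
  fixes U :: "real set"
  obtains C where "countable C" "C \<subseteq> U" "\<And>u. u \<in> U \<Longrightarrow> \<exists>c\<in>C. c \<le> u"
proof
  define c where "c q = (SOME u. u \<in> U \<and> u < q)" for q
  define Q where "Q = {q \<in> \<rat>. \<exists>u\<in>U. u < q}"
  define C where "C = c ` Q \<union> {u \<in> U. \<forall>u'\<in>U. u \<le> u'}"
  have c: "c q \<in> U \<and> c q < q" if "q \<in> Q" for q
    unfolding c_def by (rule someI_ex) (use that in \<open>auto simp: Q_def\<close>)
  have "countable Q" unfolding Q_def by (rule countable_subset[OF _ countable_rat]) auto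
  moreover have "countable {u \<in> U. \<forall>u'\<in>U. u \<le> u'}"
    by (rule countable_subset[of _ "{Inf U}"]) (auto intro!: cInf_eq_minimum[symmetric])
  ultimately show "countable C" unfolding C_def by simp
  show "C \<subseteq> U" using c by (auto simp: C_def)
  fix u assume u: "u \<in> U"
  show "\<exists>c\<in>C. c \<le> u"
  proof (cases "\<forall>u'\<in>U. u \<le> u'")
    case True
    then show ?thesis using u by (auto simp: C_def)
  next
    case False
    then obtain u' where "u' \<in> U" "u' < u" by force
    moreover obtain q where "q \<in> \<rat>" "u' < q" "q < u" using Rats_dense_in_real[OF \<open>u' < u\<close>] by blast
    ultimately have "q \<in> Q" by (auto simp: Q_def)
    then have "c q \<in> C" "c q \<le> u" using c[of q] \<open>q < u\<close> by (auto simp: C_def)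
    then show ?thesis by blast
  qed
qed

text \<open>The events \<open>e x < s\<close> grow with \<open>s\<close>, so those for a countable
  coinitial set imply all the others. If then \<open>e x\<close> were in \<open>U\<close>, some
  \<open>c\<close> of that set would satisfy both \<open>c \<le> e x\<close> and
  \<open>e x < c\<close>.\<close>

lemma AE_notin_of_tails:
  fixes e :: "'a \<Rightarrow> real"
  assumes "\<And>s. s \<in> U \<Longrightarrow> AE x in N. e x < s"
  shows "AE x in N. e x \<notin> U"
proof -
  obtain C where C: "countable C" "C \<subseteq> U" "\<And>u. u \<in> U \<Longrightarrow> \<exists>c\<in>C. c \<le> u"
    using countable_coinitial_subset[of U] by metis
  have "AE x in N. \<forall>c\<in>C. e x < c"
    using C(1,2) assms by (auto simp: AE_ball_countable)
  then show ?thesis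
  proof eventually_elim
    case (elim x)
    then show ?case using C(3)[of "e x"] by force
  qed
qed

section \<open>The sunlight is bounded by the irrigation cost\<close>

lemma space_arc_length [simp]: "space arc_length = unit_circle"
  by (simp add: arc_length_def space_restrict_space)

lemma sets_arc_length [simp, measurable_cong]: "sets arc_length = sets (restrict_space borel unit_circle)"
  by (simp add: arc_length_def)

lemma measurable_arc_length_id [measurable]: "(\<lambda>n. n) \<in> measurable arc_length borel"
  unfolding measurable_cong_sets[OF sets_arc_length refl] by (rule measurable_restrict_space1) simp

lemma finite_measure_arc_length: "finite_measure arc_length"
  unfolding arc_length_def
proof (rule finite_measure.finite_measure_distr)
  show "finite_measure (restrict_space lborel {0..<2 * pi})"
    by (rule finite_measureI) (simp add: space_restrict_space emeasure_restrict_space)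
  have eq: "(\<lambda>\<theta>. vector [cos \<theta>, sin \<theta>] :: real^2) = (\<lambda>\<theta>. cos \<theta> *\<^sub>R axis 1 1 + sin \<theta> *\<^sub>R axis 2 1)"
    by (rule ext) (simp add: vec_eq_iff forall_2 axis_def)
  show "(\<lambda>\<theta>. vector [cos \<theta>, sin \<theta>]) \<in>
      measurable (restrict_space lborel {0..<2 * pi}) (restrict_space borel unit_circle)"
  proof (rule measurable_restrict_space2)
    show "(\<lambda>\<theta>. vector [cos \<theta>, sin \<theta>] :: real^2) \<in> measurable (restrict_space lborel {0..<2 * pi}) borel"
    proof (rule measurable_restrict_space1)
      have "(\<lambda>\<theta>. cos \<theta> *\<^sub>R axis 1 1 + sin \<theta> *\<^sub>R axis 2 1 :: real^2) \<in> borel_measurable borel"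
        by measurable
      then show "(\<lambda>\<theta>. vector [cos \<theta>, sin \<theta>] :: real^2) \<in> borel_measurable lborel"
        by (simp add: eq)
    qed
    show "(\<lambda>\<theta>. vector [cos \<theta>, sin \<theta>]) \<in> space (restrict_space lborel {0..<2 * pi}) \<rightarrow> unit_circle"
      by (auto simp: norm_eq_1 inner_real2 simp flip: power2_eq_square)
  qed
qed

lemma nn_integral_directional_light:
  assumes \<eta>: "integrable arc_length \<eta>" "AE n in arc_length. 0 \<le> \<eta> n"
  shows "(\<integral>\<^sup>+n. ennreal \<bar>w \<bullet> n\<bar> * ennreal (\<eta> n) \<partial>arc_length) = ennreal (directional_light \<eta> w)"
proof -
  have [measurable]: "\<eta> \<in> borel_measurable arc_length" using \<eta>(1) by auto
  have int: "integrable arc_length (\<lambda>n. \<bar>w \<bullet> n\<bar> * \<eta> n)"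
  proof (rule Bochner_Integration.integrable_bound[where f="\<lambda>n. norm w * \<eta> n"])
    show "AE n in arc_length. norm (\<bar>w \<bullet> n\<bar> * \<eta> n) \<le> norm (norm w * \<eta> n)"
    proof (rule AE_I2)
      fix n assume "n \<in> space arc_length"
      then have "\<bar>w \<bullet> n\<bar> \<le> norm w" using Cauchy_Schwarz_ineq2[of w n] by simp
      then show "norm (\<bar>w \<bullet> n\<bar> * \<eta> n) \<le> norm (norm w * \<eta> n)"
        by (auto simp: abs_mult intro!: mult_right_mono)
    qed
  qed (use \<eta> in auto)
  have "(\<integral>\<^sup>+n. ennreal \<bar>w \<bullet> n\<bar> * ennreal (\<eta> n) \<partial>arc_length) = (\<integral>\<^sup>+n. ennreal (\<bar>w \<bullet> n\<bar> * \<eta> n) \<partial>arc_length)"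
    by (simp add: ennreal_mult')
  also have "\<dots> = ennreal (directional_light \<eta> w)"
    unfolding directional_light_def using \<eta>(2)
    by (intro nn_integral_eq_integral[OF int]) auto
  finally show ?thesis .
qed

lemma directional_light_le_max_light:
  assumes "integrable arc_length \<eta>" "norm w = 1"
  shows "directional_light \<eta> w \<le> max_light \<eta>"
proof -
  have "w \<in> unit_circle" using assms(2) by simp
  with max_light_is_maximum[OF assms(1)] show ?thesis by metis
qed

text \<open>Up to the factor \<open>norm d\<close> the integrand belongs to the unit vector in
  direction \<open>rot90 d\<close>, a competitor in the maximum that defines K. The zero vector has
  no direction and is treated apart.\<close>

lemma nn_integral_rot90_light_le:
  assumes \<eta>: "integrable arc_length \<eta>" "AE n in arc_length. 0 \<le> \<eta> n"
  shows "(\<integral>\<^sup>+n. ennreal \<bar>d \<bullet> rot90 n\<bar> * ennreal (\<eta> n) \<partial>arc_length)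
    \<le> ennreal (max_light \<eta>) * ennreal (norm d)"
proof (cases "d = 0")
  case False
  define u where "u = rot90 d /\<^sub>R norm d"
  have u: "norm u = 1" using False by (simp add: u_def)
  have [measurable]: "\<eta> \<in> borel_measurable arc_length" using \<eta>(1) by auto
  have "ennreal \<bar>d \<bullet> rot90 n\<bar> = ennreal (norm d) * ennreal \<bar>u \<bullet> n\<bar>" for n
    using False by (simp add: inner_rot90_right u_def abs_mult flip: ennreal_mult')
  then have "(\<integral>\<^sup>+n. ennreal \<bar>d \<bullet> rot90 n\<bar> * ennreal (\<eta> n) \<partial>arc_length)
    = ennreal (norm d) * (\<integral>\<^sup>+n. ennreal \<bar>u \<bullet> n\<bar> * ennreal (\<eta> n) \<partial>arc_length)"
    by (subst nn_integral_cmult[symmetric]) (simp_all add: mult.assoc)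
  also have "\<dots> = ennreal (norm d) * ennreal (directional_light \<eta> u)"
    by (simp add: nn_integral_directional_light[OF \<eta>])
  also have "\<dots> \<le> ennreal (norm d) * ennreal (max_light \<eta>)"
    using directional_light_le_max_light[OF \<eta>(1) u] by (intro mult_left_mono ennreal_leI) auto
  finally show ?thesis by (simp add: mult.commute)
qed simp

context irrigated_measure
begin

text \<open>By the intermediate value theorem a path from 0 that misses a level s \<ge> 0 must end
  below s. The monotone family of these events is handled by \<open>AE_notin_of_tails\<close>, which
  yields one null set for all levels of mass zero. Levels s \<le> 0 are treated through the negated
  endpoint.\<close>

lemma AE_endpoint_hit_mass_pos:
  "AE \<xi> in particles. hit_mass (\<lambda>x. x \<bullet> v) (\<gamma> \<xi> (T \<xi>) \<bullet> v) > 0"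
proof -
  let ?m = "hit_mass (\<lambda>x. x \<bullet> v)"
  let ?e = "\<lambda>\<xi>. \<gamma> \<xi> (T \<xi>) \<bullet> v"
  have p: "continuous_on UNIV (\<lambda>x. x \<bullet> v)" by (intro continuous_intros)
  have missed: "AE \<xi> in particles. \<forall>t\<ge>0. \<gamma> \<xi> t \<bullet> v \<noteq> s" if "?m s = 0" for s
  proof (rule AE_I)
    show "emeasure particles {\<xi> \<in> {0..M}. \<exists>t\<ge>0. \<gamma> \<xi> t \<bullet> v = s} = 0"
      using emeasure_hits[OF p, of s] that by simp
    show "{\<xi> \<in> {0..M}. \<exists>t\<ge>0. \<gamma> \<xi> t \<bullet> v = s} \<in> sets particles"
      using hits_lmeasurable[OF p, of s] by (subst sets_restrict_space_iff) auto
  qed auto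
  have ivt: "\<exists>t\<ge>0. \<gamma> \<xi> t \<bullet> v = s" if "\<xi> \<in> {0..M}" "0 \<le> s \<and> s \<le> ?e \<xi> \<or> ?e \<xi> \<le> s \<and> s \<le> 0" for \<xi> s
  proof -
    have "continuous_on {0..T \<xi>} (\<lambda>t. \<gamma> \<xi> t \<bullet> v)"
      by (intro continuous_intros continuous_on_subset[OF continuous_path[OF that(1)]]) auto
    then show ?thesis
      using that(2) start[OF that(1)] stop_nonneg[OF that(1)]
        IVT'[of "\<lambda>t. \<gamma> \<xi> t \<bullet> v" 0 s "T \<xi>"] IVT2'[of "\<lambda>t. \<gamma> \<xi> t \<bullet> v" "T \<xi>" s 0] by fastforce
  qed
  have "AE \<xi> in particles. ?e \<xi> \<notin> {s. 0 \<le> s \<and> ?m s = 0}"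
  proof (rule AE_notin_of_tails)
    fix s assume "s \<in> {s. 0 \<le> s \<and> ?m s = 0}"
    then have s: "0 \<le> s" "?m s = 0" by auto
    from missed[OF s(2)] AE_space show "AE \<xi> in particles. ?e \<xi> < s"
    proof eventually_elim
      case (elim \<xi>)
      then show ?case using ivt[of \<xi> s] s(1) by (auto simp: not_less[symmetric])
    qed
  qed
  moreover have "AE \<xi> in particles. - ?e \<xi> \<notin> {s. 0 \<le> s \<and> ?m (- s) = 0}"
  proof (rule AE_notin_of_tails)
    fix s assume "s \<in> {s. 0 \<le> s \<and> ?m (- s) = 0}"
    then have s: "0 \<le> s" "?m (- s) = 0" by auto
    from missed[OF s(2)] AE_space show "AE \<xi> in particles. - ?e \<xi> < s"
    proof eventually_elim
      case (elim \<xi>)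
      then show ?case using ivt[of \<xi> "- s"] s(1) by force
    qed
  qed
  ultimately show ?thesis
  proof eventually_elim
    case (elim \<xi>)
    then show ?case using hit_mass_nonneg[OF p, of "?e \<xi>"] by (auto simp: less_le)
  qed
qed

lemma projected_light_le_shadow:
  assumes n: "norm n = 1"
  shows "(\<integral>\<^sup>+y. ennreal (1 - exp (- projected_density \<mu> n y)) \<partial>perp_line_lebesgue n)
    \<le> emeasure lborel {s. hit_mass (\<lambda>x. x \<bullet> rot90 n) s > 0}"
proof -
  let ?m = "hit_mass (\<lambda>x. x \<bullet> rot90 n)"
  have p: "continuous_on UNIV (\<lambda>x. x \<bullet> rot90 n)" by (intro continuous_intros)
  note measurable_hit_mass[OF p, measurable]
  define Z where "Z = {s. ?m s \<le> 0}"
  have Z[measurable]: "Z \<in> sets borel" unfolding Z_def by measurable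
  have ZZ: "{x. x \<bullet> rot90 n \<in> Z} \<in> sets borel" by measurable
  have "emeasure \<mu> {x. x \<bullet> rot90 n \<in> Z} = emeasure (distr particles borel (\<lambda>\<xi>. \<gamma> \<xi> (T \<xi>))) {x. x \<bullet> rot90 n \<in> Z}"
    by (simp add: distr_endpoint)
  also have "\<dots> = emeasure particles {\<xi> \<in> space particles. \<gamma> \<xi> (T \<xi>) \<bullet> rot90 n \<in> Z}"
    by (subst emeasure_distr[OF measurable_endpoint ZZ]) (auto intro!: arg_cong[where f="emeasure particles"])
  also have "\<dots> = 0"
  proof (rule emeasure_eq_0_AE)
    show "AE \<xi> in particles. \<not> \<gamma> \<xi> (T \<xi>) \<bullet> rot90 n \<in> Z"
      using AE_endpoint_hit_mass_pos[of "rot90 n"] by eventually_elim (simp add: Z_def)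
  qed
  finally have "emeasure \<mu> {x. x \<bullet> rot90 n \<in> Z} = 0" .
  from shadow_le_of_null[OF finite sets_\<mu> n Z this] show ?thesis
    by (simp add: Z_def Compl_eq not_le)
qed

text \<open>The weight does not depend on the direction of light. Integrating first over directions,
  for a fixed particle and time, leaves K times the speed, and the speed restricts the times to
  those before stopping.\<close>

lemma sunlight_le_plan_cost:
  assumes \<eta>: "integrable arc_length \<eta>" "AE n in arc_length. 0 \<le> \<eta> n"
  shows "sunlight \<eta> \<mu> \<le> ennreal (max_light \<eta>) * plan_cost 0 M \<gamma> T"
proof -
  let ?P = "particles \<Otimes>\<^sub>M times"
  let ?w = "\<lambda>\<xi> t. flux_weight 0 (flux M \<gamma> (\<gamma> \<xi> t))"
  define w where "w = (\<lambda>(\<xi>, t). ?w \<xi> t)"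
  define D where "D = (\<lambda>(\<xi>, t). velocity \<xi> t)"
  have w[measurable]: "w \<in> borel_measurable ?P" using measurable_flux_weight by (simp add: w_def)
  have D[measurable]: "D \<in> borel_measurable ?P" using measurable_velocity by (simp add: D_def)
  interpret N: finite_measure particles by (rule finite_particles)
  interpret S: sigma_finite_measure times by (rule sigma_finite_times)
  interpret P: pair_sigma_finite particles times ..
  interpret A: finite_measure arc_length
    by (rule finite_measure_arc_length)
  interpret Q: pair_sigma_finite arc_length ?P ..
  have [measurable]: "\<eta> \<in> borel_measurable arc_length" using \<eta>(1) by auto
  note light = nn_integral_rot90_light_le[OF \<eta>]
  have "sunlight \<eta> \<mu> \<le> (\<integral>\<^sup>+n. (\<integral>\<^sup>+\<xi>. \<integral>\<^sup>+t. ?w \<xi> t * ennreal \<bar>velocity \<xi> t \<bullet> rot90 n\<bar> \<partial>times \<partial>particles) * ennreal (\<eta> n) \<partial>arc_length)"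
    unfolding sunlight_def
  proof (intro nn_integral_mono mult_right_mono)
    fix n assume "n \<in> space arc_length"
    then have "norm n = 1" by simp
    from projected_light_le_shadow[OF this] shadow_le_projected_cost[of "rot90 n"]
    show "(\<integral>\<^sup>+y. ennreal (1 - exp (- projected_density \<mu> n y)) \<partial>perp_line_lebesgue n)
      \<le> (\<integral>\<^sup>+\<xi>. \<integral>\<^sup>+t. ?w \<xi> t * ennreal \<bar>velocity \<xi> t \<bullet> rot90 n\<bar> \<partial>times \<partial>particles)" by (rule order_trans)
  qed simp
  \<comment> \<open>Particles and times are merged into one product space, so that a single exchange
    with the circle suffices.\<close>
  also have "\<dots> = (\<integral>\<^sup>+n. \<integral>\<^sup>+q. w q * ennreal \<bar>D q \<bullet> rot90 n\<bar> * ennreal (\<eta> n) \<partial>?P \<partial>arc_length)"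
  proof (intro nn_integral_cong)
    fix n
    have m: "(\<lambda>q. w q * ennreal \<bar>D q \<bullet> rot90 n\<bar>) \<in> borel_measurable ?P" by measurable
    have "(\<integral>\<^sup>+\<xi>. \<integral>\<^sup>+t. ?w \<xi> t * ennreal \<bar>velocity \<xi> t \<bullet> rot90 n\<bar> \<partial>times \<partial>particles)
      = (\<integral>\<^sup>+q. w q * ennreal \<bar>D q \<bullet> rot90 n\<bar> \<partial>?P)"
      using S.nn_integral_fst[OF m] by (simp add: w_def D_def)
    then show "(\<integral>\<^sup>+\<xi>. \<integral>\<^sup>+t. ?w \<xi> t * ennreal \<bar>velocity \<xi> t \<bullet> rot90 n\<bar> \<partial>times \<partial>particles) * ennreal (\<eta> n)
      = (\<integral>\<^sup>+q. w q * ennreal \<bar>D q \<bullet> rot90 n\<bar> * ennreal (\<eta> n) \<partial>?P)"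
      by (simp add: nn_integral_multc)
  qed
  also have "\<dots> = (\<integral>\<^sup>+q. \<integral>\<^sup>+n. w q * ennreal \<bar>D q \<bullet> rot90 n\<bar> * ennreal (\<eta> n) \<partial>arc_length \<partial>?P)"
    by (rule Q.Fubini'[symmetric]) simp
  also have "\<dots> \<le> (\<integral>\<^sup>+q. ennreal (max_light \<eta>) * (w q * ennreal (norm (D q))) \<partial>?P)"
  proof (intro nn_integral_mono)
    fix q
    have "(\<integral>\<^sup>+n. w q * ennreal \<bar>D q \<bullet> rot90 n\<bar> * ennreal (\<eta> n) \<partial>arc_length)
      = w q * (\<integral>\<^sup>+n. ennreal \<bar>D q \<bullet> rot90 n\<bar> * ennreal (\<eta> n) \<partial>arc_length)"
      by (subst nn_integral_cmult[symmetric]) (simp_all add: mult.assoc)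
    also have "\<dots> \<le> w q * (ennreal (max_light \<eta>) * ennreal (norm (D q)))"
      by (intro mult_left_mono light) simp
    finally show "(\<integral>\<^sup>+n. w q * ennreal \<bar>D q \<bullet> rot90 n\<bar> * ennreal (\<eta> n) \<partial>arc_length)
      \<le> ennreal (max_light \<eta>) * (w q * ennreal (norm (D q)))" by (simp add: mult_ac)
  qed
  also have "\<dots> = ennreal (max_light \<eta>) * (\<integral>\<^sup>+q. w q * ennreal (norm (D q)) \<partial>?P)"
    by (rule nn_integral_cmult) simp
  also have "(\<integral>\<^sup>+q. w q * ennreal (norm (D q)) \<partial>?P)
    = (\<integral>\<^sup>+\<xi>. \<integral>\<^sup>+t. ?w \<xi> t * ennreal (norm (velocity \<xi> t)) \<partial>times \<partial>particles)"
  proof -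
    have m: "(\<lambda>q. w q * ennreal (norm (D q))) \<in> borel_measurable ?P" by measurable
    show ?thesis using S.nn_integral_fst[OF m] by (simp add: w_def D_def)
  qed
  also have "\<dots> = plan_cost 0 M \<gamma> T"
    unfolding plan_cost_def
  proof (intro nn_integral_cong)
    fix \<xi> assume "\<xi> \<in> space particles"
    then have \<xi>: "\<xi> \<in> {0..M}" by simp
    have "(\<integral>\<^sup>+t. ?w \<xi> t * ennreal (norm (velocity \<xi> t)) \<partial>times) = (\<integral>\<^sup>+t. ?w \<xi> t * indicator {0..T \<xi>} t \<partial>times)"
      using AE_velocity[OF \<xi>] by (intro nn_integral_cong_AE) (auto simp: indicator_def)
    also have "\<dots> = (\<integral>\<^sup>+t. ?w \<xi> t * indicator {0..T \<xi>} t \<partial>lebesgue)"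
      by (subst nn_integral_restrict_space) (auto simp: indicator_def intro!: nn_integral_cong)
    also have "\<dots> = (\<integral>\<^sup>+t. ?w \<xi> t \<partial>lebesgue_on {0..T \<xi>})"
      by (subst nn_integral_restrict_space) auto
    finally show "(\<integral>\<^sup>+t. ?w \<xi> t * ennreal (norm (velocity \<xi> t)) \<partial>times) = (\<integral>\<^sup>+t. ?w \<xi> t \<partial>lebesgue_on {0..T \<xi>})" .
  qed
  finally show ?thesis .
qed

end

section \<open>Irrigating a segment\<close>

lemma borel_measurable_lebesgue_onI: "f \<in> borel_measurable borel \<Longrightarrow> f \<in> borel_measurable (lebesgue_on S)"
  by (rule measurable_restrict_space1) (simp add: measurable_completion)

lemma nn_integral_lebesgue_on:
  assumes "S \<in> sets borel"
  shows "(\<integral>\<^sup>+x. f x \<partial>lebesgue_on S) = (\<integral>\<^sup>+x. f x * indicator S x \<partial>lborel)"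
  using assms by (subst nn_integral_restrict_space) (auto simp: nn_integral_completion)

text \<open>The interval pushed forward is the label set of the particles, not the arc length
  parameter: label \<xi> sits at distance \<xi>/\<kappa>, which gives linear density \<kappa>.
  Condition (iii) on the plan below then holds by definition.\<close>

definition segment_measure :: "real^2 \<Rightarrow> real \<Rightarrow> real \<Rightarrow> (real^2) measure" where
  "segment_measure u \<kappa> R = distr (lebesgue_on {0..\<kappa> * R}) borel (\<lambda>\<xi>. (\<xi> / \<kappa>) *\<^sub>R u)"

definition segment_path :: "real^2 \<Rightarrow> real \<Rightarrow> real \<Rightarrow> real \<Rightarrow> real^2" where
  "segment_path u \<kappa> \<xi> t = min t (\<xi> / \<kappa>) *\<^sub>R u"

locale segment =
  fixes u :: "real^2" and \<kappa> R :: real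
  assumes u: "norm u = 1" and \<kappa>: "0 < \<kappa>" and R: "0 < R"
begin

abbreviation \<mu> :: "(real^2) measure" where "\<mu> \<equiv> segment_measure u \<kappa> R"

lemma measurable_position: "(\<lambda>\<xi>. (\<xi> / \<kappa>) *\<^sub>R u) \<in> borel_measurable (lebesgue_on {0..\<kappa> * R})"
  by (rule borel_measurable_lebesgue_onI) simp

lemma sets_segment_measure: "sets \<mu> = sets borel"
  by (simp add: segment_measure_def)

lemma finite_segment_measure: "finite_measure \<mu>"
  unfolding segment_measure_def
  by (rule finite_measure.finite_measure_distr[OF finite_measure_lebesgue_on measurable_position]) simp

lemma total_mass_segment_measure: "total_mass \<mu> = \<kappa> * R"
proof -
  have "emeasure \<mu> (space \<mu>) = emeasure (lebesgue_on {0..\<kappa> * R}) {0..\<kappa> * R}"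
    unfolding segment_measure_def by (subst emeasure_distr[OF measurable_position]) auto
  also have "\<dots> = ennreal (\<kappa> * R)"
    using \<kappa> R by (subst emeasure_restrict_space) auto
  finally show ?thesis using \<kappa> R by (simp add: measure_def)
qed

lemma segment_measure_half_plane:
  assumes "0 \<le> u $ 2"
  shows "\<mu> \<in> half_plane_measures"
proof -
  have [measurable]: "{x :: real^2. x $ 2 < 0} \<in> sets borel" by measurable
  have "0 \<le> \<xi> / \<kappa> * u $ 2" if "0 \<le> \<xi>" for \<xi>
    using assms \<kappa> that by (intro mult_nonneg_nonneg) simp_all
  then have "(\<lambda>\<xi>. (\<xi> / \<kappa>) *\<^sub>R u) -` {x. x $ 2 < 0} \<inter> space (lebesgue_on {0..\<kappa> * R}) = {}"
    by (fastforce simp: not_less)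
  then have "emeasure \<mu> {x. x $ 2 < 0} = 0"
    unfolding segment_measure_def by (subst emeasure_distr[OF measurable_position]) auto
  then show ?thesis
    by (simp add: half_plane_measures_def finite_segment_measure sets_segment_measure)
qed

lemma segment_plan: "irrigation_plan \<mu> (segment_path u \<kappa>) (\<lambda>\<xi>. \<xi> / \<kappa>)"
  unfolding irrigation_plan_def total_mass_segment_measure
proof (intro conjI ballI allI impI)
  have "(\<lambda>p. segment_path u \<kappa> (fst p) (snd p)) \<in> borel_measurable (lebesgue_on {0..\<kappa> * R} \<Otimes>\<^sub>M lebesgue_on {0..})"
  proof -
    have id: "(\<lambda>x. x) \<in> borel_measurable (lebesgue_on S)" for S :: "real set"
      by (rule borel_measurable_lebesgue_onI) simp
    have [measurable]: "fst \<in> borel_measurable (lebesgue_on {0..\<kappa> * R} \<Otimes>\<^sub>M lebesgue_on {0::real..})"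
      "snd \<in> borel_measurable (lebesgue_on {0..\<kappa> * R} \<Otimes>\<^sub>M lebesgue_on {0::real..})"
      by (rule measurable_compose[OF measurable_fst id] measurable_compose[OF measurable_snd id])+
    show ?thesis unfolding segment_path_def by measurable
  qed
  then show "(\<lambda>(\<xi>, t). segment_path u \<kappa> \<xi> t) \<in> borel_measurable (lebesgue_on {0..\<kappa> * R} \<Otimes>\<^sub>M lebesgue_on {0..})"
    by (simp add: split_beta')
  show "distr (lebesgue_on {0..\<kappa> * R}) borel (\<lambda>\<xi>. segment_path u \<kappa> \<xi> (\<xi> / \<kappa>)) = \<mu>"
    by (simp add: segment_path_def segment_measure_def)
next
  fix \<xi> assume \<xi>: "\<xi> \<in> {0..\<kappa> * R}"
  then show "0 \<le> \<xi> / \<kappa>" using \<kappa> by simp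
  then show "segment_path u \<kappa> \<xi> 0 = 0" by (simp add: segment_path_def)
  have "1-lipschitz_on {0..} (segment_path u \<kappa> \<xi>)"
    using u by (intro lipschitz_onI) (auto simp: segment_path_def dist_norm simp flip: scaleR_diff_left)
  then show "\<exists>C. C-lipschitz_on {0..} (segment_path u \<kappa> \<xi>)" ..
  \<comment> \<open>At the stopping time the path has a corner when the particle moves at all; this
    single instant is discarded.\<close>
  have "AE t in lebesgue. t \<noteq> \<xi> / \<kappa>" by (intro AE_completion AE_lborel_singleton)
  then have "AE t in lebesgue. t \<in> {0..\<xi> / \<kappa>} \<longrightarrow> (\<exists>v. (segment_path u \<kappa> \<xi> has_vector_derivative v) (at t) \<and> norm v = 1)"
  proof eventually_elim
    case (elim t)
    show ?case
    proof
      assume "t \<in> {0..\<xi> / \<kappa>}"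
      then have t: "t \<in> {..<\<xi> / \<kappa>}" using elim by auto
      have "((\<lambda>t. t *\<^sub>R u) has_vector_derivative u) (at t)"
        by (auto intro!: derivative_eq_intros)
      then have "(segment_path u \<kappa> \<xi> has_vector_derivative u) (at t)"
        by (rule has_vector_derivative_transform_within_open[OF _ _ t]) (auto simp: segment_path_def)
      then show "\<exists>v. (segment_path u \<kappa> \<xi> has_vector_derivative v) (at t) \<and> norm v = 1" using u by auto
    qed
  qed
  then show "AE t in lebesgue_on {0..\<xi> / \<kappa>}. \<exists>v. (segment_path u \<kappa> \<xi> has_vector_derivative v) (at t) \<and> norm v = 1"
    by (subst AE_restrict_space_iff) auto
next
  fix \<xi> t assume "\<xi> / \<kappa> < t"
  then have t: "t \<in> {\<xi> / \<kappa><..}" by simp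
  have "((\<lambda>t. (\<xi> / \<kappa>) *\<^sub>R u) has_vector_derivative 0) (at t)" by simp
  then show "(segment_path u \<kappa> \<xi> has_vector_derivative 0) (at t)"
    by (rule has_vector_derivative_transform_within_open[OF _ _ t]) (auto simp: segment_path_def)
qed

text \<open>The particles through the point at distance t are those that stop there or later, with
  labels from \<kappa> t on; the flux decreases linearly and vanishes at the tip.\<close>

lemma flux_segment:
  assumes "0 \<le> t" "t \<le> R"
  shows "flux (\<kappa> * R) (segment_path u \<kappa>) (t *\<^sub>R u) = \<kappa> * (R - t)"
proof -
  have "u \<noteq> 0" using u by auto
  then have "{\<xi> \<in> {0..\<kappa> * R}. \<exists>s\<ge>0. segment_path u \<kappa> \<xi> s = t *\<^sub>R u} = {\<kappa> * t..\<kappa> * R}"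
  proof (intro equalityI subsetI)
    fix \<xi> assume \<xi>: "\<xi> \<in> {\<kappa> * t..\<kappa> * R}"
    then have "t \<le> \<xi> / \<kappa>" using \<kappa> by (simp add: pos_le_divide_eq mult.commute)
    moreover have "0 \<le> \<kappa> * t" using \<kappa> assms by simp
    ultimately show "\<xi> \<in> {\<xi> \<in> {0..\<kappa> * R}. \<exists>s\<ge>0. segment_path u \<kappa> \<xi> s = t *\<^sub>R u}"
      using \<xi> assms by (auto simp: segment_path_def min_absorb1 intro!: exI[of _ t])
  next
    fix \<xi> assume "\<xi> \<in> {\<xi> \<in> {0..\<kappa> * R}. \<exists>s\<ge>0. segment_path u \<kappa> \<xi> s = t *\<^sub>R u}"
    then obtain s where "\<xi> \<in> {0..\<kappa> * R}" "min s (\<xi> / \<kappa>) = t"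
      using \<open>u \<noteq> 0\<close> by (auto simp: segment_path_def)
    moreover from this have "t \<le> \<xi> / \<kappa>" by simp
    ultimately show "\<xi> \<in> {\<kappa> * t..\<kappa> * R}"
      using \<kappa> by (simp add: pos_le_divide_eq mult.commute)
  qed
  then show ?thesis using assms \<kappa> by (simp add: flux_def algebra_simps)
qed

text \<open>Integrated over the particles first, each point at distance t contributes its inverse
  flux times the mass passing through it, hence 1. The density cancels and only the length is
  left.\<close>

lemma segment_cost: "irrigation_cost 0 \<mu> \<le> ennreal R"
proof -
  let ?w = "\<lambda>t. inverse (ennreal (\<kappa> * (R - t)))"
  have "plan_cost 0 (\<kappa> * R) (segment_path u \<kappa>) (\<lambda>\<xi>. \<xi> / \<kappa>)
    = (\<integral>\<^sup>+\<xi>. \<integral>\<^sup>+t. ?w t * indicator {0..\<xi> / \<kappa>} t * indicator {0..\<kappa> * R} \<xi> \<partial>lborel \<partial>lborel)"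
    unfolding plan_cost_def
  proof (simp add: nn_integral_lebesgue_on nn_integral_multc[symmetric], intro nn_integral_cong, goal_cases)
    case (1 \<xi>)
    have "(\<integral>\<^sup>+t. flux_weight 0 (flux (\<kappa> * R) (segment_path u \<kappa>) (segment_path u \<kappa> \<xi> t)) * indicator {0..\<xi> / \<kappa>} t \<partial>lborel)
       = (\<integral>\<^sup>+t. ?w t * indicator {0..\<xi> / \<kappa>} t \<partial>lborel)" if "\<xi> \<in> {0..\<kappa> * R}"
    proof (intro nn_integral_cong)
      fix t
      show "flux_weight 0 (flux (\<kappa> * R) (segment_path u \<kappa>) (segment_path u \<kappa> \<xi> t)) * indicator {0..\<xi> / \<kappa>} t
        = ?w t * indicator {0..\<xi> / \<kappa>} t"
      proof (cases "t \<in> {0..\<xi> / \<kappa>}")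
        case True
        then have t: "0 \<le> t" "t \<le> \<xi> / \<kappa>" by auto
        moreover have "\<xi> / \<kappa> \<le> R" using that \<kappa> by (simp add: divide_le_eq mult.commute)
        ultimately have "t \<le> R" by linarith
        with t flux_segment[of t] \<kappa> show ?thesis
          by (simp add: segment_path_def min_absorb1 flux_weight_0_inverse)
      qed simp
    qed
    then show ?case by (cases "\<xi> \<in> {0..\<kappa> * R}") (simp_all add: nn_integral_multc)
  qed
  also have "\<dots> = (\<integral>\<^sup>+t. \<integral>\<^sup>+\<xi>. ?w t * indicator {0..\<xi> / \<kappa>} t * indicator {0..\<kappa> * R} \<xi> \<partial>lborel \<partial>lborel)"
  proof (rule lborel_pair.Fubini')
    have "(\<lambda>(t, \<xi>). ?w t * (if 0 \<le> t \<and> t \<le> \<xi> / \<kappa> then 1 else 0) * indicator {0..\<kappa> * R} \<xi>)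
       \<in> borel_measurable (lborel \<Otimes>\<^sub>M lborel)" by measurable
    then show "(\<lambda>(t, \<xi>). ?w t * indicator {0..\<xi> / \<kappa>} t * indicator {0..\<kappa> * R} \<xi>) \<in> borel_measurable (lborel \<Otimes>\<^sub>M lborel)"
      by (simp add: indicator_def of_bool_def)
  qed
  also have "\<dots> \<le> (\<integral>\<^sup>+t. indicator {0..R} t \<partial>lborel)"
  proof (intro nn_integral_mono)
    fix t
    have "(\<integral>\<^sup>+\<xi>. ?w t * indicator {0..\<xi> / \<kappa>} t * indicator {0..\<kappa> * R} \<xi> \<partial>lborel)
      \<le> (\<integral>\<^sup>+\<xi>. ?w t * indicator {0..} t * indicator {\<kappa> * t..\<kappa> * R} \<xi> \<partial>lborel)"
      using \<kappa> by (intro nn_integral_mono) (auto simp: indicator_def field_simps)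
    also have "\<dots> = ?w t * indicator {0..} t * emeasure lborel {\<kappa> * t..\<kappa> * R}"
      by (rule nn_integral_cmult_indicator) simp
    also have "\<dots> \<le> indicator {0..R} t"
    proof (cases "0 \<le> t \<and> t < R")
      case True
      then have "0 < \<kappa> * (R - t)" using \<kappa> by simp
      moreover have "emeasure lborel {\<kappa> * t..\<kappa> * R} = ennreal (\<kappa> * (R - t))"
        using True \<kappa> by (simp add: algebra_simps)
      moreover have "inverse (ennreal x) * ennreal x = 1" if "0 < x" for x
        using that by (simp add: inverse_ennreal flip: ennreal_mult)
      ultimately show ?thesis using True by simp
    next
      case False
      \<comment> \<open>At the tip \<open>t = R\<close> the weight is infinite, but a single label
        arrives there, and infinity times 0 is 0.\<close>
      then have "t < 0 \<or> emeasure lborel {\<kappa> * t..\<kappa> * R} = 0"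
        using \<kappa> by (cases "t = R") auto
      then show ?thesis by auto
    qed
    finally show "(\<integral>\<^sup>+\<xi>. ?w t * indicator {0..\<xi> / \<kappa>} t * indicator {0..\<kappa> * R} \<xi> \<partial>lborel) \<le> indicator {0..R} t" .
  qed
  also have "\<dots> = ennreal R" using R by simp
  finally have "plan_cost 0 (total_mass \<mu>) (segment_path u \<kappa>) (\<lambda>\<xi>. \<xi> / \<kappa>) \<le> ennreal R"
    by (simp add: total_mass_segment_measure)
  moreover have "irrigation_cost 0 \<mu> \<le> plan_cost 0 (total_mass \<mu>) (segment_path u \<kappa>) (\<lambda>\<xi>. \<xi> / \<kappa>)"
    unfolding irrigation_cost_def using segment_plan by (intro Inf_lower) blast
  ultimately show ?thesis by simp
qed

text \<open>The projection contracts length by the factor |p|, where p is the inner product of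
  \<open>u\<close> and \<open>rot90 n\<close>, and so raises the density from \<kappa> to
  \<kappa>/|p|. Dividing the coordinate by p describes the shadow for both signs of p.\<close>

lemma projected_segment_eq_density:
  assumes n: "norm n = 1" and p: "u \<bullet> rot90 n \<noteq> 0"
  shows "projected_measure n \<mu> = density (perp_line_lebesgue n)
    (\<lambda>y. ennreal (\<kappa> / \<bar>u \<bullet> rot90 n\<bar>) * indicator {0..R} (y \<bullet> rot90 n / (u \<bullet> rot90 n)))"
proof (rule measure_eqI)
  let ?S = "restrict_space borel (perp_line n)"
  let ?p = "u \<bullet> rot90 n"
  show "sets (projected_measure n \<mu>) = sets (density (perp_line_lebesgue n)
    (\<lambda>y. ennreal (\<kappa> / \<bar>?p\<bar>) * indicator {0..R} (y \<bullet> rot90 n / ?p)))"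
    by (simp add: projected_measure_def)
  fix A assume "A \<in> sets (projected_measure n \<mu>)"
  then have A[measurable]: "A \<in> sets ?S" by (simp add: projected_measure_def)
  have ray[measurable]: "(\<lambda>s. s *\<^sub>R rot90 n) \<in> measurable borel ?S"
    using measurable_scale_rot90[of n] by simp
  have [measurable]: "(\<lambda>s. indicator A (s *\<^sub>R rot90 n) :: ennreal) \<in> borel_measurable borel"
    using measurable_compose[OF ray borel_measurable_indicator[OF A]] by simp
  have "projected_measure n \<mu> = distr (lebesgue_on {0..\<kappa> * R}) ?S (\<lambda>\<xi>. (\<xi> / \<kappa> * ?p) *\<^sub>R rot90 n)"
    unfolding projected_measure_def segment_measure_def
    by (subst distr_distr[OF measurable_perp_proj[OF n] measurable_position]) (simp_all add: o_def perp_proj_eq[OF n])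
  moreover have T: "(\<lambda>\<xi>. (\<xi> / \<kappa> * ?p) *\<^sub>R rot90 n) \<in> measurable (lebesgue_on {0..\<kappa> * R}) ?S"
    by (rule measurable_restrict_space2) (auto simp: perp_line_def intro!: borel_measurable_lebesgue_onI)
  ultimately have "emeasure (projected_measure n \<mu>) A = (\<integral>\<^sup>+\<xi>. indicator A ((\<xi> / \<kappa> * ?p) *\<^sub>R rot90 n) \<partial>lebesgue_on {0..\<kappa> * R})"
    using A by (subst nn_integral_indicator[symmetric]) (simp, simp only:, subst nn_integral_distr[OF T], simp, rule refl)
  also have "\<dots> = (\<integral>\<^sup>+\<xi>. indicator A ((\<xi> / \<kappa> * ?p) *\<^sub>R rot90 n) * indicator {0..\<kappa> * R} \<xi> \<partial>lborel)"
    by (rule nn_integral_lebesgue_on) simp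
  \<comment> \<open>Substitution \<xi> = (\<kappa>/p) s, which makes s the coordinate along
    \<open>rot90 n\<close>.\<close>
  also have "\<dots> = ennreal \<bar>\<kappa> / ?p\<bar> * (\<integral>\<^sup>+s. indicator A (((0 + \<kappa> / ?p * s) / \<kappa> * ?p) *\<^sub>R rot90 n) * indicator {0..\<kappa> * R} (0 + \<kappa> / ?p * s) \<partial>lborel)"
    by (rule nn_integral_real_affine) (use p \<kappa> in auto)
  also have "\<dots> = ennreal (\<kappa> / \<bar>?p\<bar>) * (\<integral>\<^sup>+s. indicator A (s *\<^sub>R rot90 n) * indicator {0..R} (s / ?p) \<partial>lborel)"
  proof -
    have "\<kappa> / ?p * s \<in> {0..\<kappa> * R} \<longleftrightarrow> s / ?p \<in> {0..R}" for s
    proof -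
      have "\<kappa> / ?p * s = \<kappa> * (s / ?p)" by simp
      then show ?thesis using \<kappa> by (simp only: atLeastAtMost_iff zero_le_mult_iff mult_le_cancel_left_pos) auto
    qed
    then show ?thesis using p \<kappa> by (simp add: indicator_def)
  qed
  also have "\<dots> = (\<integral>\<^sup>+s. ennreal (\<kappa> / \<bar>?p\<bar>) * indicator {0..R} (s / ?p) * indicator A (s *\<^sub>R rot90 n) \<partial>lborel)"
    by (subst nn_integral_cmult[symmetric]) (simp_all add: mult_ac)
  also have "\<dots> = (\<integral>\<^sup>+y. ennreal (\<kappa> / \<bar>?p\<bar>) * indicator {0..R} (y \<bullet> rot90 n / ?p) * indicator A y \<partial>perp_line_lebesgue n)"
    using n by (subst nn_integral_perp_line_lebesgue) (simp_all add: dot_square_norm)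
  also have "\<dots> = emeasure (density (perp_line_lebesgue n)
    (\<lambda>y. ennreal (\<kappa> / \<bar>?p\<bar>) * indicator {0..R} (y \<bullet> rot90 n / ?p))) A"
    by (rule emeasure_density[symmetric]) simp_all
  finally show "emeasure (projected_measure n \<mu>) A = emeasure (density (perp_line_lebesgue n)
    (\<lambda>y. ennreal (\<kappa> / \<bar>?p\<bar>) * indicator {0..R} (y \<bullet> rot90 n / ?p))) A" .
qed

text \<open>Projection never dilutes: |p| \<le> 1 keeps the projected density at least \<kappa> on a
  shadow of length R |p|. If p = 0 the lower bound is 0.\<close>

lemma projected_light_segment_ge:
  assumes n: "norm n = 1"
  shows "ennreal (R * (1 - exp (- \<kappa>))) * ennreal \<bar>u \<bullet> rot90 n\<bar>
    \<le> (\<integral>\<^sup>+y. ennreal (1 - exp (- projected_density \<mu> n y)) \<partial>perp_line_lebesgue n)"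
proof (cases "u \<bullet> rot90 n = 0")
  case False
  let ?L = "perp_line_lebesgue n" and ?\<nu> = "projected_measure n \<mu>" and ?p = "u \<bullet> rot90 n"
  let ?f = "\<lambda>y. ennreal (\<kappa> / \<bar>?p\<bar>) * indicator {0..R} (y \<bullet> rot90 n / ?p)"
  interpret L: sigma_finite_measure ?L by (rule sigma_finite_perp_line_lebesgue[OF n])
  note \<nu> = projected_segment_eq_density[OF n False]
  have f[measurable]: "?f \<in> borel_measurable ?L" by simp
  have "lebesgue_decomposition ?L ?\<nu> ?\<nu> (null_measure ?L)"
    unfolding lebesgue_decomposition_def using absolutely_continuousI_density[OF f]
    by (auto simp: \<nu> intro!: bexI[of _ "{}"])
  from ac_part_eqI[OF this] have ac: "ac_part ?L ?\<nu> = ?\<nu>" .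
  have "\<bar>?p\<bar> \<le> 1" using Cauchy_Schwarz_ineq2[of u "rot90 n"] u n by simp
  then have dens: "exp (- (\<kappa> / \<bar>?p\<bar>)) \<le> exp (- \<kappa>)" using False \<kappa> by (simp add: field_simps)
  have "AE y in ?L. ?f y = RN_deriv ?L ?\<nu> y"
    by (rule L.RN_deriv_unique[OF f]) (simp add: \<nu>)
  then have "AE y in ?L. ennreal (1 - exp (- \<kappa>)) * indicator {0..R} (y \<bullet> rot90 n / ?p)
      \<le> ennreal (1 - exp (- projected_density \<mu> n y))"
  proof eventually_elim
    case (elim y)
    have "projected_density \<mu> n y = \<kappa> / \<bar>?p\<bar> * indicator {0..R} (y \<bullet> rot90 n / ?p)"
      using \<kappa> unfolding projected_density_def ac elim[symmetric] by (simp add: indicator_def)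
    then show ?case using dens by (auto simp: indicator_def intro!: ennreal_leI)
  qed
  then have "(\<integral>\<^sup>+y. ennreal (1 - exp (- \<kappa>)) * indicator {0..R} (y \<bullet> rot90 n / ?p) \<partial>?L)
    \<le> (\<integral>\<^sup>+y. ennreal (1 - exp (- projected_density \<mu> n y)) \<partial>?L)" by (rule nn_integral_mono_AE)
  also have "(\<integral>\<^sup>+y. ennreal (1 - exp (- \<kappa>)) * indicator {0..R} (y \<bullet> rot90 n / ?p) \<partial>?L)
    = (\<integral>\<^sup>+s. ennreal (1 - exp (- \<kappa>)) * indicator {0..R} (s / ?p) \<partial>lborel)"
    using n by (subst nn_integral_perp_line_lebesgue) (simp_all add: dot_square_norm)
  also have "\<dots> = ennreal \<bar>?p\<bar> * (\<integral>\<^sup>+s. ennreal (1 - exp (- \<kappa>)) * indicator {0..R} ((0 + ?p * s) / ?p) \<partial>lborel)"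
    by (rule nn_integral_real_affine) (use False in auto)
  also have "\<dots> = ennreal \<bar>?p\<bar> * (ennreal (1 - exp (- \<kappa>)) * ennreal R)"
    using False R by (simp add: nn_integral_cmult_indicator)
  also have "\<dots> = ennreal (R * (1 - exp (- \<kappa>))) * ennreal \<bar>?p\<bar>"
    using R by (simp add: ennreal_mult' mult_ac)
  finally show ?thesis .
qed simp

lemma sunlight_segment_ge:
  assumes \<eta>: "integrable arc_length \<eta>" "AE n in arc_length. 0 \<le> \<eta> n"
  shows "ennreal (R * (1 - exp (- \<kappa>)) * directional_light \<eta> (rot90 u)) \<le> sunlight \<eta> \<mu>"
proof -
  have [measurable]: "\<eta> \<in> borel_measurable arc_length" using \<eta>(1) by auto
  have "ennreal (R * (1 - exp (- \<kappa>)) * directional_light \<eta> (rot90 u))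
    = ennreal (R * (1 - exp (- \<kappa>))) * (\<integral>\<^sup>+n. ennreal \<bar>rot90 u \<bullet> n\<bar> * ennreal (\<eta> n) \<partial>arc_length)"
    using R \<kappa> by (simp add: nn_integral_directional_light[OF \<eta>] ennreal_mult')
  also have "\<dots> = (\<integral>\<^sup>+n. ennreal (R * (1 - exp (- \<kappa>))) * ennreal \<bar>u \<bullet> rot90 n\<bar> * ennreal (\<eta> n) \<partial>arc_length)"
    by (subst nn_integral_cmult[symmetric]) (simp_all add: inner_rot90_right mult.assoc)
  also have "\<dots> \<le> sunlight \<eta> \<mu>"
    unfolding sunlight_def
    by (intro nn_integral_mono mult_right_mono projected_light_segment_ge) auto
  finally show ?thesis .
qed

lemma payoff_segment_ge:
  assumes \<eta>: "integrable arc_length \<eta>" "AE n in arc_length. 0 \<le> \<eta> n" and c: "0 \<le> c"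
  shows "ereal (R * ((1 - exp (- \<kappa>)) * directional_light \<eta> (rot90 u) - c)) \<le> payoff \<eta> c 0 \<mu>"
proof -
  let ?a = "R * (1 - exp (- \<kappa>)) * directional_light \<eta> (rot90 u)"
  let ?I = "irrigation_cost 0 \<mu>"
  have fin: "?I \<noteq> \<infinity>" using segment_cost by (auto simp: top_unique)
  obtain i where i: "?I = ennreal i" "0 \<le> i" using fin by (cases ?I) auto
  have "i \<le> R" using segment_cost i R by simp
  \<comment> \<open>The conversion to \<open>ennreal\<close> cuts negative values off at 0, which
    only raises them.\<close>
  have "ereal ?a \<le> enn2ereal (ennreal ?a)"
    by (cases "0 \<le> ?a") (simp_all add: ennreal_neg zero_ennreal.rep_eq)
  also have "\<dots> \<le> enn2ereal (sunlight \<eta> \<mu>)"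
    using sunlight_segment_ge[OF \<eta>] by (simp add: less_eq_ennreal.rep_eq)
  finally have "ereal ?a - ereal (c * R) \<le> enn2ereal (sunlight \<eta> \<mu>) - ereal (c * i)"
    using \<open>i \<le> R\<close> c by (intro ereal_minus_mono) (auto intro: mult_left_mono)
  then show ?thesis using i fin by (simp add: payoff_def algebra_simps)
qed

end

section \<open>The optimization problem\<close>

text \<open>Dividing by c turns the bounds for single plans into a lower bound for the infimum, also
  when there is no plan and the infimum is infinite. A positive c \<ge> K is used because K itself
  may be 0 and could not be divided by.\<close>

lemma sunlight_le_irrigation_cost:
  assumes \<eta>: "integrable arc_length \<eta>" "AE n in arc_length. 0 \<le> \<eta> n"
    and \<mu>: "\<mu> \<in> half_plane_measures" and c: "max_light \<eta> \<le> c" "0 < c"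
  shows "sunlight \<eta> \<mu> \<le> ennreal c * irrigation_cost 0 \<mu>"
proof -
  have inv: "ennreal (inverse c) * ennreal c = 1" using c by (simp flip: ennreal_mult)
  have inv': "ennreal c * ennreal (inverse c) = 1" using inv by (subst mult.commute)
  have "ennreal (inverse c) * sunlight \<eta> \<mu> \<le> irrigation_cost 0 \<mu>"
    unfolding irrigation_cost_def
  proof (rule Inf_greatest)
    fix x assume "x \<in> {plan_cost 0 (total_mass \<mu>) \<gamma> T | \<gamma> T. irrigation_plan \<mu> \<gamma> T}"
    then obtain \<gamma> T where x: "x = plan_cost 0 (total_mass \<mu>) \<gamma> T" "irrigation_plan \<mu> \<gamma> T" by blast
    have "irrigated_measure \<mu> \<gamma> T"
      using \<mu> x(2) by (simp add: irrigated_measure_def half_plane_measures_def)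
    then have "sunlight \<eta> \<mu> \<le> ennreal (max_light \<eta>) * x"
      unfolding x(1) using \<eta> by (rule irrigated_measure.sunlight_le_plan_cost)
    also have "\<dots> \<le> ennreal c * x" using c by (intro mult_right_mono ennreal_leI) auto
    finally have "ennreal (inverse c) * sunlight \<eta> \<mu> \<le> ennreal (inverse c) * (ennreal c * x)"
      by (intro mult_left_mono) auto
    then show "ennreal (inverse c) * sunlight \<eta> \<mu> \<le> x" by (simp add: inv flip: mult.assoc)
  qed
  then have "ennreal c * (ennreal (inverse c) * sunlight \<eta> \<mu>) \<le> ennreal c * irrigation_cost 0 \<mu>"
    by (intro mult_left_mono) auto
  then show ?thesis by (simp add: inv' flip: mult.assoc)
qed

section \<open>The zero measure\<close>

lemma null_measure_half_plane: "null_measure borel \<in> half_plane_measures"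
  by (auto simp: half_plane_measures_def intro!: finite_measureI)

lemma irrigation_cost_null_measure: "irrigation_cost 0 (null_measure borel) = 0"
proof -
  let ?N = "null_measure borel :: (real^2) measure"
  have M: "total_mass ?N = 0" by (simp add: measure_def)
  \<comment> \<open>The label set is the single point 0, a null set, so the plan that never moves
    has the zero measure as push-forward and costs nothing.\<close>
  have null: "emeasure (lebesgue_on {0..0::real}) A = 0" for A
  proof -
    have "emeasure (lebesgue_on {0..0::real}) (space (lebesgue_on {0..0::real})) = 0"
      by (simp add: emeasure_restrict_space)
    then show ?thesis using emeasure_space[of "lebesgue_on {0..0::real}" A] by simp
  qed
  have AE: "AE t in lebesgue_on {0..0::real}. P t" for P
    by (rule AE_I[OF _ null[of "{0}"]]) auto
  have distr: "distr (lebesgue_on {0..0::real}) borel (\<lambda>\<xi>. 0) = ?N"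
    by (rule measure_eqI) (simp_all only: emeasure_distr[OF measurable_const] null sets_distr sets_null_measure
        emeasure_null_measure UNIV_I space_borel)
  have lip: "\<exists>C. C-lipschitz_on {0..} (\<lambda>t::real. 0 :: real^2)"
    by (intro exI[of _ 0] lipschitz_onI) auto
  have "irrigation_plan ?N (\<lambda>\<xi> t. 0) (\<lambda>\<xi>. 0)"
    unfolding irrigation_plan_def M
  proof (intro conjI ballI allI impI)
    show "AE t in lebesgue_on {0..0}. \<exists>v. ((\<lambda>t. 0) has_vector_derivative v) (at t) \<and> norm v = 1"
      by (rule AE)
    show "\<exists>C. C-lipschitz_on {0..} (\<lambda>t::real. 0 :: real^2)" by (rule lip)
    show "distr (lebesgue_on {0..0::real}) borel (\<lambda>\<xi>. 0) = ?N" by (rule distr)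
    show "(\<lambda>(\<xi>, t). 0) \<in> borel_measurable (lebesgue_on {0..0::real} \<Otimes>\<^sub>M lebesgue_on {0::real..})"
      by (simp add: split_beta')
    show "((\<lambda>t. 0) has_vector_derivative 0) (at t)" for t
      by (rule has_vector_derivative_const)
  qed simp_all
  then have "irrigation_cost 0 ?N \<le> plan_cost 0 (total_mass ?N) (\<lambda>\<xi> t. 0) (\<lambda>\<xi>. 0)"
    unfolding irrigation_cost_def by (intro Inf_lower) blast
  also have "\<dots> = (\<integral>\<^sup>+ \<xi>. 0 \<partial>lebesgue_on {0..0::real})"
    unfolding plan_cost_def M by (intro nn_integral_cong_AE AE)
  finally show ?thesis by simp
qed

theorem theorem2p8:
  fixes \<eta> :: "real^2 \<Rightarrow> real" and c :: real
  assumes "c > 0"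
    and "integrable arc_length \<eta>"
    and "AE n in arc_length. 0 \<le> \<eta> n"
  shows "(max_light \<eta> > c \<longrightarrow>
            (SUP \<mu>\<in>half_plane_measures. payoff \<eta> c 0 \<mu>) = \<infinity> \<and>
            \<not> (\<exists>\<mu>\<in>half_plane_measures.
                  \<forall>\<nu>\<in>half_plane_measures. payoff \<eta> c 0 \<nu> \<le> payoff \<eta> c 0 \<mu>)) \<and>
         (max_light \<eta> \<le> c \<longrightarrow>
            (\<forall>\<mu>\<in>half_plane_measures. payoff \<eta> c 0 \<mu> \<le> 0) \<and>
            null_measure borel \<in> half_plane_measures \<and>
            payoff \<eta> c 0 (null_measure borel) = 0)"
proof (intro conjI impI)
  note c = assms(1) and \<eta> = assms(2,3)
  note light_le_cost = sunlight_le_irrigation_cost[OF \<eta>]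
  show "null_measure borel \<in> half_plane_measures" by (rule null_measure_half_plane)
  show "payoff \<eta> c 0 (null_measure borel) = 0"
  proof -
    have "sunlight \<eta> (null_measure borel) \<le> 0"
      \<comment> \<open>The constant multiplies the cost 0; the maximum is both positive and at
        least K.\<close>
      using light_le_cost[OF null_measure_half_plane, of "max c (max_light \<eta>)"] c
      by (simp add: irrigation_cost_null_measure)
    then show ?thesis by (simp add: payoff_def irrigation_cost_null_measure zero_ennreal.rep_eq)
  qed
  show "\<forall>\<mu>\<in>half_plane_measures. payoff \<eta> c 0 \<mu> \<le> 0" if K: "max_light \<eta> \<le> c"
  proof
    fix \<mu> assume \<mu>: "\<mu> \<in> half_plane_measures"
    show "payoff \<eta> c 0 \<mu> \<le> 0"
    proof (cases "irrigation_cost 0 \<mu> = \<infinity>")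
      case False
      then obtain i where i: "irrigation_cost 0 \<mu> = ennreal i" "0 \<le> i"
        by (cases "irrigation_cost 0 \<mu>") auto
      have "sunlight \<eta> \<mu> \<le> ennreal (c * i)"
        using light_le_cost[OF \<mu> K c] i c by (simp add: ennreal_mult)
      then obtain s where "sunlight \<eta> \<mu> = ennreal s" "0 \<le> s" "s \<le> c * i"
        using i c by (cases "sunlight \<eta> \<mu>") (auto simp: top_unique)
      with i False show ?thesis by (simp add: payoff_def)
    qed (simp add: payoff_def)
  qed
  assume K: "c < max_light \<eta>"
  have unbounded: "\<exists>\<mu>\<in>half_plane_measures. ereal B \<le> payoff \<eta> c 0 \<mu>" for B
  proof -
    let ?K = "max_light \<eta>"
    obtain w where w: "norm w = 1" "directional_light \<eta> w = ?K"
      using max_light_is_maximum[OF \<eta>(1)] by auto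
    have rot: "rot90 (rot90 w) = - w" "rot90 (- rot90 w) = w"
      by (simp_all add: vec_eq_iff forall_2)
    have even: "directional_light \<eta> (- w) = directional_light \<eta> w"
      by (simp add: directional_light_def)
    \<comment> \<open>Both vectors orthogonal to \<open>w\<close> see the same light, and one of
      them points into the upper half plane.\<close>
    obtain u where unit: "norm u = 1" and upper: "0 \<le> u $ 2" and light: "directional_light \<eta> (rot90 u) = ?K"
    proof (cases "0 \<le> rot90 w $ 2")
      case True
      then show ?thesis using w even rot that[of "rot90 w"] by simp
    next
      case False
      then show ?thesis using w rot that[of "- rot90 w"] by simp
    qed
    \<comment> \<open>Solves (1 - exp (-\<kappa>)) K - c = (K - c)/2: half of the surplus K - c is
      kept per unit of length.\<close>
    define \<kappa> where "\<kappa> = ln (2 * ?K / (?K - c))"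
    have "1 < 2 * ?K / (?K - c)" using c K by (simp add: field_simps)
    then have \<kappa>: "0 < \<kappa>" by (simp add: \<kappa>_def)
    have "exp (- \<kappa>) = (?K - c) / (2 * ?K)" using c K by (simp add: \<kappa>_def exp_minus)
    then have gain: "(1 - exp (- \<kappa>)) * ?K - c = (?K - c) / 2" using c K by (simp add: field_simps)
    \<comment> \<open>At a profit of (K - c)/2 per unit of length this reaches \<open>B\<close>; the
      maximum with 1 keeps the length positive when \<open>B \<le> 0\<close>.\<close>
    define R where "R = max 1 (2 * B / (?K - c))"
    have seg: "segment u \<kappa> R" using unit \<kappa> by (simp add: segment_def R_def less_max_iff_disj)
    have "2 * B / (?K - c) \<le> R" by (simp add: R_def)
    then have "B \<le> R * ((?K - c) / 2)" using c K by (simp add: field_simps)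
    then have "ereal B \<le> ereal (R * ((1 - exp (- \<kappa>)) * directional_light \<eta> (rot90 u) - c))"
      by (simp add: light gain)
    also have "\<dots> \<le> payoff \<eta> c 0 (segment_measure u \<kappa> R)"
      using c K by (intro segment.payoff_segment_ge[OF seg \<eta>]) simp
    finally show ?thesis using segment.segment_measure_half_plane[OF seg upper] by blast
  qed
  show sup: "(SUP \<mu>\<in>half_plane_measures. payoff \<eta> c 0 \<mu>) = \<infinity>"
    by (rule ereal_top) (meson unbounded SUP_upper2)
  show "\<not> (\<exists>\<mu>\<in>half_plane_measures. \<forall>\<nu>\<in>half_plane_measures. payoff \<eta> c 0 \<nu> \<le> payoff \<eta> c 0 \<mu>)"
  proof
    assume "\<exists>\<mu>\<in>half_plane_measures. \<forall>\<nu>\<in>half_plane_measures. payoff \<eta> c 0 \<nu> \<le> payoff \<eta> c 0 \<mu>"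
    then obtain \<mu> where \<mu>: "\<mu> \<in> half_plane_measures"
      "\<And>\<nu>. \<nu> \<in> half_plane_measures \<Longrightarrow> payoff \<eta> c 0 \<nu> \<le> payoff \<eta> c 0 \<mu>" by blast
    \<comment> \<open>A maximizer would need payoff +infinity, hence finite cost together with
      infinite sunlight; the upper bound with K as constant contradicts this.\<close>
    then have "(SUP \<mu>\<in>half_plane_measures. payoff \<eta> c 0 \<mu>) \<le> payoff \<eta> c 0 \<mu>" by (intro SUP_least)
    then have top: "payoff \<eta> c 0 \<mu> = \<infinity>" by (simp add: sup)
    then have "irrigation_cost 0 \<mu> \<noteq> \<infinity>" by (auto simp: payoff_def)
    then obtain i where i: "irrigation_cost 0 \<mu> = ennreal i" "0 \<le> i"
      by (cases "irrigation_cost 0 \<mu>") auto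
    have "sunlight \<eta> \<mu> \<le> ennreal (max_light \<eta>) * irrigation_cost 0 \<mu>"
      using c K by (intro light_le_cost[OF \<mu>(1)]) auto
    also have "\<dots> < \<infinity>" using i by (simp add: ennreal_mult_less_top)
    finally obtain s where "sunlight \<eta> \<mu> = ennreal s" "0 \<le> s" by (cases "sunlight \<eta> \<mu>") auto
    with i top show False by (simp add: payoff_def)
  qed
qed

end
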